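(* Let $i$ be a positive integer. Then for any integer $n\ge i$, $$\lambda^i\bigl(\{1,\dots,n\}\bigr)=(-1)^i\sum_{\mu\vdash i}(-1)^{\ell(\mu)}\binom{\ell(\mu)}{\alpha(\mu)}\,\bigl[\mathcal{P}_\mu^{(n)}\bigr]\in\mathcal{B}(\Sigma_n).$$
   Context: $\Sigma_n$ is the symmetric group on $\{1,\dots,n\}$, and $\{1,\dots,n\}$ is regarded as a $\Sigma_n$-set in the natural way. For a finite group $G$, $\mathcal{B}(G)$ denotes the Burnside ring: the Grothendieck ring of finite $G$-sets, with addition given by disjoint union and multiplication by Cartesian product; $[S]$ is the class of the $G$-set $S$. For a function $f$ on $\mathcal{B}(G)$ write $f(S)$ for $f([S])$. $\lambda$-structure on $\mathcal{B}(G)$: for a finite $G$-set $S$ let $\sigma^n(S)=[S^n/\Sigma_n]$ be the class of the $n$th symmetric power of $S$ (with $\sigma^0(S)=1$). This extends uniquely to $\mathcal{B}(G)$ by requiring that $\sigma_t(x):=\sum_{i\ge 0}\sigma^i(x)t^i\in\mathcal{B}(G)[[t]]$ satisfies $\sigma_t(x+y)=\sigma_t(x)\sigma_t(y)$. The operations $\lambda^i$ on $\mathcal{B}(G)$ are defined as the opposite structure: with $\lambda_t(x):=\sum_{i\ge0}\lambda^i(x)t^i$, one requires $\sigma_t(x)\cdot\lambda_{-t}(x)=1$ in $\mathcal{B}(G)[[t]]$. Partitions: $\mu\vdash i$ means that $\mu=(\mu_1,\dots,\mu_l)$ is a partition of $i$ into positive parts $\mu_1\ge\dots\ge\mu_l$;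 its length is $\ell(\mu)=l$. If $\mu_1=\dots=\mu_{\alpha_1}>\mu_{\alpha_1+1}=\dots=\mu_{\alpha_1+\alpha_2}>\dots>\mu_{l-\alpha_{l'}+1}=\dots=\mu_l$, then $\alpha(\mu):=(\alpha_1,\dots,\alpha_{l'})$ (the tuple of multiplicities of the distinct parts, in decreasing order of the parts), and $\binom{\ell(\mu)}{\alpha(\mu)}:=\frac{l!}{\alpha_1!\cdots\alpha_{l'}!}$. For $\mu\vdash i$ with $i\le n$, $\mathcal{P}_\mu^{(n)}$ is the $\Sigma_n$-set of $\ell(\mu)$-tuples $(T_1,\dots,T_{\ell(\mu)})$ of pairwise disjoint subsets of $\{1,\dots,n\}$ with $|T_j|=\mu_j$ for each $j$, with $\Sigma_n$ acting by $\sigma(T_1,\dots,T_{\ell(\mu)})=(\sigma T_1,\dots,\sigma T_{\ell(\mu)})$. *)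

theory Defs
  imports "HOL-Algebra.Sym_Groups" "HOL-Algebra.Group_Action" "HOL-Algebra.Ring"
begin

section \<open>Finite \<open>G\<close>-sets\<close>

text \<open>
  A \<open>G\<close>-set is a pair of an underlying set and an action. As usual for \<^locale>\<open>group_action\<close>,
  each group element acts by an extensional bijection, so the action maps below are restricted
  to the underlying set.
\<close>

type_synonym ('g, 'a) gset = "'a set \<times> ('g \<Rightarrow> 'a \<Rightarrow> 'a)"

definition finite_gset :: "('g, 'm) monoid_scheme \<Rightarrow> ('g, 'a) gset \<Rightarrow> bool"
  where "finite_gset G S \<longleftrightarrow> finite (fst S) \<and> group_action G (fst S) (snd S)"

definition gset_iso :: "('g, 'm) monoid_scheme \<Rightarrow> ('g, 'a) gset \<Rightarrow> ('g, 'b) gset \<Rightarrow> bool"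
  where "gset_iso G S T \<longleftrightarrow>
    (\<exists>f. bij_betw f (fst S) (fst T) \<and>
         (\<forall>g\<in>carrier G. \<forall>x\<in>fst S. f (snd S g x) = snd T g (f x)))"

definition gset_empty :: "('g, 'a) gset"
  where "gset_empty = ({}, \<lambda>g. \<lambda>x\<in>{}. x)"

definition gset_point :: "('g, unit) gset"
  where "gset_point = ({()}, \<lambda>g. \<lambda>x\<in>{()}. x)"

definition gset_sum :: "('g, 'a) gset \<Rightarrow> ('g, 'b) gset \<Rightarrow> ('g, 'a + 'b) gset"
  where "gset_sum S T =
    (fst S <+> fst T, \<lambda>g. \<lambda>x\<in>fst S <+> fst T. map_sum (snd S g) (snd T g) x)"

definition gset_prod :: "('g, 'a) gset \<Rightarrow> ('g, 'b) gset \<Rightarrow> ('g, 'a \<times> 'b) gset"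
  where "gset_prod S T =
    (fst S \<times> fst T, \<lambda>g. \<lambda>x\<in>fst S \<times> fst T. map_prod (snd S g) (snd T g) x)"

text \<open>
  The symmetric power \<open>S\<^sup>n / \<Sigma>\<^sub>n\<close>: an \<open>n\<close>-tuple is an extensional function on \<open>{1..n}\<close>, the group
  \<open>\<Sigma>\<^sub>n\<close> permutes the positions, and \<open>G\<close> acts entrywise on representatives of the orbits.
\<close>

definition gset_sym_power :: "nat \<Rightarrow> ('g, 'a) gset \<Rightarrow> ('g, (nat \<Rightarrow> 'a) set) gset"
  where "gset_sym_power n S =
    (let Q = orbits (sym_group n) ({1..n} \<rightarrow>\<^sub>E fst S) (\<lambda>\<pi> f. f \<circ> inv' \<pi>)
     in (Q, \<lambda>g. \<lambda>c\<in>Q. (\<lambda>f. \<lambda>j\<in>{1..n}. snd S g (f j)) ` c))"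


section \<open>The Burnside ring\<close>

text \<open>
  The formal difference \<open>[S] - [T]\<close>, as an element of the Grothendieck construction: the class of all
  pairs \<open>(S', T')\<close> with \<open>S + T' + U \<cong> S' + T + U\<close> for some finite \<open>G\<close>-set \<open>U\<close>. Each finite \<open>G\<close>-set is
  isomorphic to one on a set of natural numbers, so it suffices to let \<open>S'\<close>, \<open>T'\<close>, \<open>U\<close> range over
  those; \<open>S\<close> and \<open>T\<close> themselves may live on any type.
\<close>

type_synonym 'g burnside = "(('g, nat) gset \<times> ('g, nat) gset) set"

definition burnside_diff ::
    "('g, 'm) monoid_scheme \<Rightarrow> ('g, 'a) gset \<Rightarrow> ('g, 'b) gset \<Rightarrow> 'g burnside"
  where "burnside_diff G S T =
    {(S', T'). finite_gset G S' \<and> finite_gset G T' \<and>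
       (\<exists>U :: ('g, nat) gset. finite_gset G U \<and>
          gset_iso G (gset_sum (gset_sum S T') U) (gset_sum (gset_sum S' T) U))}"

definition burnside_class :: "('g, 'm) monoid_scheme \<Rightarrow> ('g, 'a) gset \<Rightarrow> 'g burnside"
  where "burnside_class G S = burnside_diff G S (gset_empty :: ('g, nat) gset)"

text \<open>
  In the operations, all choices of representatives give the same class, so each union is
  over copies of a single class.
\<close>

definition burnside_ring :: "('g, 'm) monoid_scheme \<Rightarrow> 'g burnside ring"
  where "burnside_ring G =
    \<lparr> carrier = {burnside_diff G S T | (S :: ('g, nat) gset) (T :: ('g, nat) gset).
                   finite_gset G S \<and> finite_gset G T},
      mult = (\<lambda>x y. \<Union>(S, T)\<in>x. \<Union>(S', T')\<in>y.
                burnside_diff G (gset_sum (gset_prod S S') (gset_prod T T'))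
                                (gset_sum (gset_prod S T') (gset_prod T S'))),
      one = burnside_class G gset_point,
      zero = burnside_class G (gset_empty :: ('g, nat) gset),
      add = (\<lambda>x y. \<Union>(S, T)\<in>x. \<Union>(S', T')\<in>y.
                burnside_diff G (gset_sum S S') (gset_sum T T')) \<rparr>"


section \<open>The \<open>\<lambda>\<close>-structure\<close>

text \<open>Formal power series over a ring, given by their coefficient sequences.\<close>

definition series_one :: "('r, 'm) ring_scheme \<Rightarrow> nat \<Rightarrow> 'r"
  where "series_one R = (\<lambda>n. if n = 0 then \<one>\<^bsub>R\<^esub> else \<zero>\<^bsub>R\<^esub>)"

definition series_mult :: "('r, 'm) ring_scheme \<Rightarrow> (nat \<Rightarrow> 'r) \<Rightarrow> (nat \<Rightarrow> 'r) \<Rightarrow> nat \<Rightarrow> 'r"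
  where "series_mult R a b = (\<lambda>n. \<Oplus>\<^bsub>R\<^esub>k\<in>{..n}. a k \<otimes>\<^bsub>R\<^esub> b (n - k))"

definition series_neg_arg :: "('r, 'm) ring_scheme \<Rightarrow> (nat \<Rightarrow> 'r) \<Rightarrow> nat \<Rightarrow> 'r"
  where "series_neg_arg R a = (\<lambda>n. [((- 1 :: int) ^ n)] \<cdot>\<^bsub>R\<^esub> a n)" \<comment> \<open>\<open>a(-t)\<close>\<close>

text \<open>
  \<open>burnside_sigma_series G x\<close> is the coefficient sequence of \<open>\<sigma>\<^sub>t(x)\<close>, and likewise for \<open>\<lambda>\<^sub>t(x)\<close>.
  The map \<open>x \<mapsto> \<sigma>\<^sub>t(x)\<close> is taken to be extensional on the ring, which makes it unique as a HOL function.
\<close>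

definition burnside_sigma_series :: "('g, 'm) monoid_scheme \<Rightarrow> 'g burnside \<Rightarrow> nat \<Rightarrow> 'g burnside"
  where "burnside_sigma_series G =
    (THE s. s \<in> carrier (burnside_ring G) \<rightarrow>\<^sub>E (UNIV \<rightarrow> carrier (burnside_ring G)) \<and>
       (\<forall>S :: ('g, nat) gset. finite_gset G S \<longrightarrow>
          (\<forall>n. s (burnside_class G S) n = burnside_class G (gset_sym_power n S))) \<and>
       (\<forall>x\<in>carrier (burnside_ring G). \<forall>y\<in>carrier (burnside_ring G).
          s (x \<oplus>\<^bsub>burnside_ring G\<^esub> y) = series_mult (burnside_ring G) (s x) (s y)))"

definition burnside_lambda_series :: "('g, 'm) monoid_scheme \<Rightarrow> 'g burnside \<Rightarrow> nat \<Rightarrow> 'g burnside"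
  where "burnside_lambda_series G x =
    (THE l. l \<in> UNIV \<rightarrow> carrier (burnside_ring G) \<and>
       series_mult (burnside_ring G) (burnside_sigma_series G x)
         (series_neg_arg (burnside_ring G) l) = series_one (burnside_ring G))"

definition burnside_lambda :: "('g, 'm) monoid_scheme \<Rightarrow> nat \<Rightarrow> 'g burnside \<Rightarrow> 'g burnside"
  where "burnside_lambda G i x = burnside_lambda_series G x i"


section \<open>Partitions and the \<open>\<Sigma>\<^sub>n\<close>-sets \<open>\<P>\<^sub>\<mu>\<close>\<close>

definition partitions_of :: "nat \<Rightarrow> nat list set"
  where "partitions_of i = {\<mu>. sorted_wrt (\<ge>) \<mu> \<and> (\<forall>m\<in>set \<mu>. 0 < m) \<and> sum_list \<mu> = i}"

definition part_mults :: "nat list \<Rightarrow> nat list"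
  where "part_mults \<mu> = map (count_list \<mu>) (remdups \<mu>)" \<comment> \<open>\<open>\<alpha>(\<mu>)\<close>; on a sorted list \<open>remdups\<close> preserves the order\<close>

definition multinomial :: "nat \<Rightarrow> nat list \<Rightarrow> nat"
  where "multinomial l \<alpha> = fact l div prod_list (map fact \<alpha>)" \<comment> \<open>exact if \<open>sum_list \<alpha> = l\<close>\<close>

definition natural_gset :: "nat \<Rightarrow> (nat \<Rightarrow> nat, nat) gset"
  where "natural_gset n = ({1..n}, \<lambda>\<pi>. restrict \<pi> {1..n})"

definition partition_gset :: "nat \<Rightarrow> nat list \<Rightarrow> (nat \<Rightarrow> nat, nat set list) gset"
  where "partition_gset n \<mu> =
    (let P = {Ts. length Ts = length \<mu> \<and>
                  (\<forall>j<length \<mu>. Ts ! j \<subseteq> {1..n} \<and> card (Ts ! j) = \<mu> ! j) \<and>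
                  (\<forall>j<length \<mu>. \<forall>k<length \<mu>. j \<noteq> k \<longrightarrow> Ts ! j \<inter> Ts ! k = {})}
     in (P, \<lambda>\<pi>. \<lambda>Ts\<in>P. map ((`) \<pi>) Ts))"

end

theory Submission
  imports Defs "HOL-Combinatorics.Multiset_Permutations"
    "HOL-Computational_Algebra.Formal_Power_Series"
begin

text \<open>
  By Burnside's theorem a finite \<open>G\<close>-set is determined up to isomorphism by its marks, the numbers of
  fixed points of the subsets \<open>H\<close> of \<open>G\<close>. Hence the Burnside ring embeds into the ring of integer valued
  functions of \<open>H\<close>, and its identities can be checked by counting \<open>H\<close>-fixed points. Since \<open>\<sigma>\<^sup>n\<close> counts
  \<open>H\<close>-fixed multisets of size \<open>n\<close>, the theorem says that the generating function of \<open>H\<close>-fixed multisets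
  on \<open>{1..n}\<close> is inverse to that of the tuples \<open>Ts\<close> of disjoint nonempty \<open>H\<close>-stable subsets,
  counted with sign \<open>(-1)\<close> to the length of \<open>Ts\<close>. This follows from a sign-reversing involution on the
  pairs of a fixed multiset and such a tuple.
\<close>

section \<open>Finite \<open>G\<close>-sets and their marks\<close>

text \<open>Both operations are given by definite descriptions: \<open>burnside_sigma_series\<close>
  is the extension of the symmetric powers that turns sums into products,
  \<open>burnside_lambda_series\<close> the solution of an inverse equation. Existence and
  uniqueness therefore come before any coefficient. Marks settle these as well: at each
  \<open>H\<close> the coefficients become integers, and integer power series form an integral
  domain, in which a series with constant coefficient 1 can be cancelled. The obstacle is that the
  mark of a symmetric power at \<open>H\<close> is not a function of the mark of the set at
  \<open>H\<close>; it depends on the sizes of all orbits under \<open>H\<close>. Equal marks of two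
  sets must first be turned back into an isomorphism, by Burnside's theorem, before their symmetric
  powers can be compared. The multinomial coefficients come from order: the inverse series counts
  tuples whose sizes stand in any order, while a partition fixes one order, and the coefficient
  counts the distinct rearrangements of its parts.\<close>

definition fixed_points :: "('g, 'a) gset \<Rightarrow> 'g set \<Rightarrow> 'a set"
  where "fixed_points S H = {x \<in> fst S. \<forall>h\<in>H. snd S h x = x}"

text \<open>\<open>H\<close> ranges over subsets: a point is fixed by \<open>H\<close> iff it is
  fixed by the subgroup that \<open>H\<close> generates. The value is an integer so that formal
  differences have marks too.\<close>

definition mark :: "('g, 'a) gset \<Rightarrow> 'g set \<Rightarrow> int"
  where "mark S H = int (card (fixed_points S H))"

lemma finite_gset_finite: "finite_gset G S \<Longrightarrow> finite (fst S)"
  by (simp add: finite_gset_def)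

lemma finite_fixed_points: "finite_gset G S \<Longrightarrow> finite (fixed_points S H)"
  by (simp add: finite_gset_def fixed_points_def)

lemma finite_gset_group: "finite_gset G S \<Longrightarrow> group G"
  by (simp add: finite_gset_def group_action_def group_hom_def)

lemma finite_gset_action:
  assumes "finite_gset G S" "g \<in> carrier G"
  shows "snd S g \<in> fst S \<rightarrow>\<^sub>E fst S"
proof -
  interpret group_action G "fst S" "snd S"
    using assms(1) by (simp add: finite_gset_def)
  show ?thesis
    using bij_prop0[OF assms(2)] surj_prop[OF assms(2)]
    by (auto simp: Bij_def PiE_def)
qed

lemma finite_gset_closed:
  "finite_gset G S \<Longrightarrow> g \<in> carrier G \<Longrightarrow> x \<in> fst S \<Longrightarrow> snd S g x \<in> fst S"
  using finite_gset_action by (metis PiE_mem)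

lemma finite_gset_one:
  assumes "finite_gset G S" "x \<in> fst S"
  shows "snd S \<one>\<^bsub>G\<^esub> x = x"
proof -
  interpret group_action G "fst S" "snd S"
    using assms(1) by (simp add: finite_gset_def)
  show ?thesis
    using id_eq_one assms(2) by (metis restrict_apply)
qed

lemma finite_gset_mult:
  assumes "finite_gset G S" "x \<in> fst S" "g \<in> carrier G" "h \<in> carrier G"
  shows "snd S (g \<otimes>\<^bsub>G\<^esub> h) x = snd S g (snd S h x)"
proof -
  interpret group_action G "fst S" "snd S"
    using assms(1) by (simp add: finite_gset_def)
  show ?thesis
    using composition_rule assms by simp
qed

lemma finite_gset_inv:
  assumes "finite_gset G S" "x \<in> fst S" "g \<in> carrier G"
  shows "snd S (inv\<^bsub>G\<^esub> g) (snd S g x) = x" "snd S g (snd S (inv\<^bsub>G\<^esub> g) x) = x"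
proof -
  interpret group G
    using assms(1) by (rule finite_gset_group)
  show "snd S (inv\<^bsub>G\<^esub> g) (snd S g x) = x" "snd S g (snd S (inv\<^bsub>G\<^esub> g) x) = x"
    using finite_gset_mult[OF assms(1,2), of "inv\<^bsub>G\<^esub> g" g] finite_gset_mult[OF assms(1,2), of g "inv\<^bsub>G\<^esub> g"]
      finite_gset_one[OF assms(1,2)] assms(3) by simp_all
qed

text \<open>Bijectivity follows from the action of the inverse element. Extensionality is a premise
  because \<open>BijGroup\<close> consists of extensional maps and the homomorphism law is an
  equality of functions.\<close>

lemma finite_gsetI:
  assumes "group G" "finite (fst S)"
    and ext: "\<And>g. g \<in> carrier G \<Longrightarrow> snd S g \<in> fst S \<rightarrow>\<^sub>E fst S"
    and one: "\<And>x. x \<in> fst S \<Longrightarrow> snd S \<one>\<^bsub>G\<^esub> x = x"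
    and mult: "\<And>g h x. g \<in> carrier G \<Longrightarrow> h \<in> carrier G \<Longrightarrow> x \<in> fst S \<Longrightarrow>
      snd S (g \<otimes>\<^bsub>G\<^esub> h) x = snd S g (snd S h x)"
  shows "finite_gset G S"
proof -
  interpret group G by fact
  have cl: "snd S g x \<in> fst S" if "g \<in> carrier G" "x \<in> fst S" for g x
    using ext[OF that(1)] that(2) by auto
  have inv: "snd S (inv\<^bsub>G\<^esub> g) (snd S g x) = x" "snd S g (snd S (inv\<^bsub>G\<^esub> g) x) = x"
    if "g \<in> carrier G" "x \<in> fst S" for g x
    using mult[of "inv\<^bsub>G\<^esub> g" g x] mult[of g "inv\<^bsub>G\<^esub> g" x] one[of x] that by simp_all
  have bij: "snd S g \<in> Bij (fst S)" if g: "g \<in> carrier G" for g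
  proof -
    have "bij_betw (snd S g) (fst S) (fst S)"
      by (rule bij_betw_byWitness[where f' = "snd S (inv\<^bsub>G\<^esub> g)"]) (use inv cl g in auto)
    then show ?thesis
      using ext[OF g] by (auto simp: Bij_def PiE_def)
  qed
  have "snd S \<in> hom G (BijGroup (fst S))"
  proof (rule homI)
    fix g h assume gh: "g \<in> carrier G" "h \<in> carrier G"
    have "snd S (g \<otimes>\<^bsub>G\<^esub> h) = compose (fst S) (snd S g) (snd S h)"
    proof (rule extensionalityI[of _ "fst S"])
      show "snd S (g \<otimes>\<^bsub>G\<^esub> h) \<in> extensional (fst S)"
        using ext[of "g \<otimes>\<^bsub>G\<^esub> h"] gh by (auto simp: PiE_def)
    qed (use mult gh in \<open>auto simp: compose_def\<close>)
    then show "snd S (g \<otimes>\<^bsub>G\<^esub> h) = snd S g \<otimes>\<^bsub>BijGroup (fst S)\<^esub> snd S h"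
      using bij gh by (simp add: BijGroup_def)
  qed (use bij in \<open>simp add: BijGroup_def\<close>)
  then show ?thesis
    using assms(1,2) group_BijGroup
    by (auto simp: finite_gset_def group_action_def group_hom_def group_hom_axioms_def)
qed

text \<open>An injective equivariant map reflects the action laws. This spares checking them on
  copies over the natural numbers and on orbits of tuples.\<close>

lemma finite_gset_transport:
  assumes T: "finite_gset G T" and f: "bij_betw f (fst S) (fst T)"
    and ext: "\<And>g. g \<in> carrier G \<Longrightarrow> snd S g \<in> fst S \<rightarrow>\<^sub>E fst S"
    and eq: "\<And>g x. g \<in> carrier G \<Longrightarrow> x \<in> fst S \<Longrightarrow> f (snd S g x) = snd T g (f x)"
  shows "finite_gset G S"
proof (rule finite_gsetI)
  show gr: "group G" using T by (rule finite_gset_group)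
  interpret group G by fact
  show "finite (fst S)"
    using f T bij_betw_finite by (auto simp: finite_gset_def)
  have cl: "snd S g x \<in> fst S" if "g \<in> carrier G" "x \<in> fst S" for g x
    using ext[OF that(1)] that(2) by auto
  have fT: "f x \<in> fst T" if "x \<in> fst S" for x
    using f that by (rule bij_betwE[THEN bspec])
  have inj: "inj_on f (fst S)" using f by (rule bij_betw_imp_inj_on)
  show "snd S \<one>\<^bsub>G\<^esub> x = x" if x: "x \<in> fst S" for x
    by (rule inj_onD[OF inj]) (use x cl eq finite_gset_one[OF T fT[OF x]] in auto)
  show "snd S (g \<otimes>\<^bsub>G\<^esub> h) x = snd S g (snd S h x)"
    if "g \<in> carrier G" "h \<in> carrier G" and x: "x \<in> fst S" for g h x
    by (rule inj_onD[OF inj]) (use that cl eq finite_gset_mult[OF T fT[OF x]] in auto)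
qed (use ext in auto)

text \<open>Elements of the Burnside ring contain only pairs of sets over \<open>nat\<close>. This
  supplies such a pair for sets on any type.\<close>

lemma ex_nat_gset:
  assumes S: "finite_gset G S"
  obtains S' :: "('g, nat) gset" where "finite_gset G S'" "gset_iso G S' S"
proof -
  obtain f where f: "bij_betw f {..<card (fst S)} (fst S)"
    using finite_gset_finite[OF S] ex_bij_betw_nat_finite atLeast0LessThan by metis
  define N where "N = {..<card (fst S)}"
  define S' :: "('g, nat) gset" where "S' = (N, \<lambda>g. \<lambda>x\<in>N. inv_into N f (snd S g (f x)))"
  have f: "bij_betw f (fst S') (fst S)" using f by (simp add: S'_def N_def)
  have "snd S g (f x) \<in> f ` N" if "g \<in> carrier G" "x \<in> N" for g x
    using f that finite_gset_closed[OF S that(1)] by (auto simp: bij_betw_def S'_def)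
  then have ext: "snd S' g \<in> fst S' \<rightarrow>\<^sub>E fst S'"
    and eq: "x \<in> fst S' \<Longrightarrow> f (snd S' g x) = snd S g (f x)" if "g \<in> carrier G" for g x
    using that by (auto simp: S'_def inv_into_into f_inv_into_f)
  show ?thesis
    using that[of S'] finite_gset_transport[OF S f ext eq] f eq by (auto simp: gset_iso_def)
qed

section \<open>Marks of sums, products, the empty set and the point\<close>

lemma mark_gset_sum:
  assumes "finite_gset G S" "finite_gset G T"
  shows "mark (gset_sum S T) H = mark S H + mark T H"
proof -
  have "fixed_points (gset_sum S T) H = fixed_points S H <+> fixed_points T H"
    by (auto simp: fixed_points_def gset_sum_def)
  then show ?thesis
    using assms[THEN finite_fixed_points] by (simp add: mark_def card_Plus)
qed

lemma mark_gset_prod: "mark (gset_prod S T) H = mark S H * mark T H"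
proof -
  have "fixed_points (gset_prod S T) H = fixed_points S H \<times> fixed_points T H"
    by (auto simp: fixed_points_def gset_prod_def)
  then show ?thesis
    by (simp add: mark_def card_cartesian_product)
qed

lemma mark_gset_empty [simp]: "mark gset_empty H = 0"
  by (simp add: mark_def fixed_points_def gset_empty_def)

lemma mark_gset_point [simp]: "mark gset_point H = 1"
proof -
  have "fixed_points gset_point H = {()}"
    by (auto simp: fixed_points_def gset_point_def)
  then show ?thesis by (simp add: mark_def)
qed

text \<open>Stated for bare families of maps, so that it serves whole sets, stable subsets of them
  and multisets alike.\<close>

lemma card_fixed_eq:
  assumes f: "bij_betw f A B"
    and eq: "\<And>h x. h \<in> H \<Longrightarrow> x \<in> A \<Longrightarrow> \<phi> h x \<in> A \<and> f (\<phi> h x) = \<psi> h (f x)"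
  shows "card {x \<in> A. \<forall>h\<in>H. \<phi> h x = x} = card {y \<in> B. \<forall>h\<in>H. \<psi> h y = y}"
proof -
  have inj: "inj_on f A" and im: "f ` A = B" using f by (auto simp: bij_betw_def)
  have "\<psi> h (f x) = f x \<longleftrightarrow> \<phi> h x = x" if "x \<in> A" "h \<in> H" for x h
    using eq[OF that(2,1)] inj_on_eq_iff[OF inj, of "\<phi> h x" x] that(1) by metis
  then have "f ` {x \<in> A. \<forall>h\<in>H. \<phi> h x = x} = {y \<in> B. \<forall>h\<in>H. \<psi> h y = y}"
    using im by auto
  then show ?thesis
    using card_image[OF inj_on_subset[OF inj, of "{x \<in> A. \<forall>h\<in>H. \<phi> h x = x}"]] by auto
qed

lemma mark_iso:
  assumes "gset_iso G S T" "finite_gset G S" "H \<subseteq> carrier G"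
  shows "mark S H = mark T H"
proof -
  from assms(1) obtain f where f: "bij_betw f (fst S) (fst T)"
    "\<And>g x. g \<in> carrier G \<Longrightarrow> x \<in> fst S \<Longrightarrow> f (snd S g x) = snd T g (f x)"
    by (auto simp: gset_iso_def)
  have "snd S h x \<in> fst S \<and> f (snd S h x) = snd T h (f x)" if "h \<in> H" "x \<in> fst S" for h x
    using f(2) finite_gset_closed[OF assms(2)] assms(3) that by auto
  from card_fixed_eq[where H = H and \<phi> = "snd S" and \<psi> = "snd T", OF f(1) this] show ?thesis
    by (simp add: mark_def fixed_points_def)
qed

section \<open>Closure of finite sets with action under sums and products\<close>

lemma finite_gset_empty: "group G \<Longrightarrow> finite_gset G gset_empty"
  by (rule finite_gsetI) (auto simp: gset_empty_def)

lemma finite_gset_point: "group G \<Longrightarrow> finite_gset G gset_point"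
  by (rule finite_gsetI) (auto simp: gset_point_def)

lemma finite_gset_sum:
  assumes S: "finite_gset G S" and T: "finite_gset G T"
  shows "finite_gset G (gset_sum S T)"
proof -
  interpret group G using S by (rule finite_gset_group)
  show ?thesis
    by (rule finite_gsetI)
      (auto simp: gset_sum_def is_group finite_gset_closed[OF S] finite_gset_closed[OF T]
         finite_gset_finite[OF S] finite_gset_finite[OF T] finite_gset_one[OF S] finite_gset_one[OF T]
         finite_gset_mult[OF S] finite_gset_mult[OF T])
qed

lemma finite_gset_prod:
  assumes S: "finite_gset G S" and T: "finite_gset G T"
  shows "finite_gset G (gset_prod S T)"
proof -
  interpret group G using S by (rule finite_gset_group)
  show ?thesis
    by (rule finite_gsetI)
      (auto simp: gset_prod_def is_group finite_gset_closed[OF S] finite_gset_closed[OF T]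
         finite_gset_finite[OF S] finite_gset_finite[OF T] finite_gset_one[OF S] finite_gset_one[OF T]
         finite_gset_mult[OF S] finite_gset_mult[OF T])
qed

text \<open>The fibres of the orbit map are the left cosets of the stabilizer. Hence the stabilizer
  of a point determines its orbit up to isomorphism.\<close>

lemma gset_action_eq_iff:
  assumes S: "finite_gset G S" "x \<in> fst S" and g: "g \<in> carrier G" "h \<in> carrier G"
  shows "snd S g x = snd S h x \<longleftrightarrow> inv\<^bsub>G\<^esub> h \<otimes>\<^bsub>G\<^esub> g \<in> stabilizer G (snd S) x"
proof -
  interpret group G using S(1) by (rule finite_gset_group)
  have ih: "inv\<^bsub>G\<^esub> h \<in> carrier G" using g by simp
  have gx: "snd S g x \<in> fst S" using S g by (simp add: finite_gset_closed)
  have "snd S (inv\<^bsub>G\<^esub> h) (snd S g x) = x \<longleftrightarrow> snd S g x = snd S h x"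
    using finite_gset_inv[OF S(1) gx g(2)] finite_gset_inv[OF S g(2)] by metis
  then show ?thesis
    using finite_gset_mult[OF S ih g(1)] g by (simp add: stabilizer_def)
qed

text \<open>Burnside's theorem on marks. A point whose stabilizer is maximal has a counterpart with the same
  stabilizer on the other side; the two orbits are isomorphic and can be removed.\<close>

theorem gset_iso_of_marks:
  assumes S: "finite_gset G S" and T: "finite_gset G T"
    and marks: "\<And>H. H \<subseteq> carrier G \<Longrightarrow> mark S H = mark T H"
  shows "gset_iso G S T"
proof -
  interpret group G using S by (rule finite_gset_group)
  define \<phi> \<psi> where "\<phi> = snd S" and "\<psi> = snd T"
  \<comment> \<open>The induction runs over stable subsets of the two fixed sets, so that removing
    an orbit keeps the same action maps.\<close>
  have "\<exists>f. bij_betw f A B \<and> (\<forall>g\<in>carrier G. \<forall>x\<in>A. f (\<phi> g x) = \<psi> g (f x))"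
    if "A \<subseteq> fst S" "B \<subseteq> fst T"
      "\<And>g x. g \<in> carrier G \<Longrightarrow> x \<in> A \<Longrightarrow> \<phi> g x \<in> A"
      "\<And>g x. g \<in> carrier G \<Longrightarrow> x \<in> B \<Longrightarrow> \<psi> g x \<in> B"
      "\<And>H. H \<subseteq> carrier G \<Longrightarrow> card {x \<in> A. \<forall>h\<in>H. \<phi> h x = x} = card {x \<in> B. \<forall>h\<in>H. \<psi> h x = x}"
    for A B
    using that
  proof (induction "card A" arbitrary: A B rule: less_induct)
    case less
    note A = less.prems(1) and B = less.prems(2) and stA = less.prems(3) and stB = less.prems(4)
      and mk = less.prems(5)
    have finA: "finite A" and finB: "finite B"
      using A B S T finite_subset by (auto simp: finite_gset_def)
    show ?case
    proof (cases "A = {}")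
      case True
      \<comment> \<open>The mark at the empty subset of the group is the cardinality.\<close>
      then have "B = {}" using mk[of "{}"] finB by simp
      with True show ?thesis by (auto simp: bij_betw_def)
    next
      case False
      obtain K where K: "K \<in> stabilizer G \<phi> ` A"
        and max: "\<And>K'. K' \<in> stabilizer G \<phi> ` A \<Longrightarrow> K \<subseteq> K' \<Longrightarrow> K = K'"
        using finite_has_maximal[of "stabilizer G \<phi> ` A"] finA False by auto
      from K obtain x where x: "x \<in> A" and Kx: "K = stabilizer G \<phi> x" by auto
      have KG: "K \<subseteq> carrier G" by (auto simp: Kx stabilizer_def)
      have "x \<in> {x \<in> A. \<forall>h\<in>K. \<phi> h x = x}" using x by (auto simp: Kx stabilizer_def)
      then have "card {x \<in> A. \<forall>h\<in>K. \<phi> h x = x} \<noteq> 0"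
        using finA by (auto simp: card_eq_0_iff)
      then have "card {x \<in> B. \<forall>h\<in>K. \<psi> h x = x} \<noteq> 0"
        using mk[OF KG] by simp
      then obtain y where y: "y \<in> B" and "\<forall>h\<in>K. \<psi> h y = y"
        by (auto simp: card_eq_0_iff)
      then have Ky: "K \<subseteq> stabilizer G \<psi> y" using KG by (auto simp: stabilizer_def)
      define L where "L = stabilizer G \<psi> y"
      have LG: "L \<subseteq> carrier G" by (auto simp: L_def stabilizer_def)
      have "y \<in> {x \<in> B. \<forall>h\<in>L. \<psi> h x = x}" using y by (auto simp: L_def stabilizer_def)
      then have "card {x \<in> B. \<forall>h\<in>L. \<psi> h x = x} \<noteq> 0"
        using finB by (auto simp: card_eq_0_iff)
      then have "card {x \<in> A. \<forall>h\<in>L. \<phi> h x = x} \<noteq> 0"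
        using mk[OF LG] by simp
      then obtain x' where x': "x' \<in> A" "\<forall>h\<in>L. \<phi> h x' = x'"
        by (auto simp: card_eq_0_iff)
      then have "L \<subseteq> stabilizer G \<phi> x'" using LG by (auto simp: stabilizer_def)
      \<comment> \<open>Comparing marks at \<open>K\<close> and then at \<open>L\<close> gives the
        chain from \<open>K\<close> through \<open>L\<close> to the stabilizer of \<open>x'\<close>;
        maximality of \<open>K\<close> collapses it.\<close>
      with max[of "stabilizer G \<phi> x'"] x' Ky have KL: "K = L" by (auto simp: L_def)
      have xS: "x \<in> fst S" and yT: "y \<in> fst T" using x y A B by auto
      have key: "\<phi> g x = \<phi> h x \<longleftrightarrow> \<psi> g y = \<psi> h y" if "g \<in> carrier G" "h \<in> carrier G" for g h
        using gset_action_eq_iff[OF S xS that] gset_action_eq_iff[OF T yT that] KL Kx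
        by (simp add: L_def \<phi>_def \<psi>_def)
      define O1 P where "O1 = (\<lambda>g. \<phi> g x) ` carrier G" and "P = (\<lambda>g. \<psi> g y) ` carrier G"
      \<comment> \<open>The orbit isomorphism sends \<open>\<phi> g x\<close> to
        \<open>\<psi> g y\<close>. By \<open>key\<close> the chosen \<open>g\<close> does not
        matter.\<close>
      define f0 where "f0 z = \<psi> (SOME g. g \<in> carrier G \<and> \<phi> g x = z) y" for z
      have f0: "f0 (\<phi> g x) = \<psi> g y" if g: "g \<in> carrier G" for g
      proof -
        have "(SOME h. h \<in> carrier G \<and> \<phi> h x = \<phi> g x) \<in> carrier G \<and>
          \<phi> (SOME h. h \<in> carrier G \<and> \<phi> h x = \<phi> g x) x = \<phi> g x"
          by (rule someI[of _ g]) (use g in simp)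
        then show ?thesis using key[OF _ g] unfolding f0_def by blast
      qed
      have bij0: "bij_betw f0 O1 P"
        unfolding bij_betw_def O1_def P_def using f0 key
        by (auto simp: inj_on_def image_image)
      have mulS: "\<phi> g (\<phi> h x) = \<phi> (g \<otimes>\<^bsub>G\<^esub> h) x" and mulT: "\<psi> g (\<psi> h y) = \<psi> (g \<otimes>\<^bsub>G\<^esub> h) y"
        if "g \<in> carrier G" "h \<in> carrier G" for g h
        using finite_gset_mult[OF S xS that] finite_gset_mult[OF T yT that]
        by (simp_all add: \<phi>_def \<psi>_def)
      have eq0: "\<phi> g z \<in> O1 \<and> f0 (\<phi> g z) = \<psi> g (f0 z)" if "g \<in> carrier G" "z \<in> O1" for g z
        using that by (auto simp: O1_def f0 mulS mulT)
      have stP: "\<psi> g z \<in> P" if "g \<in> carrier G" "z \<in> P" for g z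
        using that by (auto simp: P_def mulT)
      have OA: "O1 \<subseteq> A" and PB: "P \<subseteq> B" using x y stA stB by (auto simp: O1_def P_def)
      \<comment> \<open>The complement of an orbit is stable, since the inverse element would carry
        a point of the orbit back into it.\<close>
      have stA': "\<phi> g z \<in> A - O1" if "g \<in> carrier G" "z \<in> A - O1" for g z
      proof -
        have "\<phi> g z \<notin> O1"
        proof
          assume "\<phi> g z \<in> O1"
          then have "\<phi> (inv\<^bsub>G\<^esub> g) (\<phi> g z) \<in> O1" using eq0 that(1) by simp
          then show False using finite_gset_inv(1)[OF S _ that(1)] that A by (auto simp: \<phi>_def)
        qed
        then show ?thesis using that stA by auto
      qed
      have stB': "\<psi> g z \<in> B - P" if "g \<in> carrier G" "z \<in> B - P" for g z
      proof -
        have "\<psi> g z \<notin> P"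
        proof
          assume "\<psi> g z \<in> P"
          then have "\<psi> (inv\<^bsub>G\<^esub> g) (\<psi> g z) \<in> P" using stP that(1) by simp
          then show False using finite_gset_inv(1)[OF T _ that(1)] that B by (auto simp: \<psi>_def)
        qed
        then show ?thesis using that stB by auto
      qed
      have mk': "card {x \<in> A - O1. \<forall>h\<in>H. \<phi> h x = x} = card {x \<in> B - P. \<forall>h\<in>H. \<psi> h x = x}"
        if H: "H \<subseteq> carrier G" for H
      proof -
        have "{x \<in> A - O1. \<forall>h\<in>H. \<phi> h x = x} =
            {x \<in> A. \<forall>h\<in>H. \<phi> h x = x} - {x \<in> O1. \<forall>h\<in>H. \<phi> h x = x}"
          "{x \<in> B - P. \<forall>h\<in>H. \<psi> h x = x} =
            {x \<in> B. \<forall>h\<in>H. \<psi> h x = x} - {x \<in> P. \<forall>h\<in>H. \<psi> h x = x}"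
          by auto
        moreover have "{x \<in> O1. \<forall>h\<in>H. \<phi> h x = x} \<subseteq> {x \<in> A. \<forall>h\<in>H. \<phi> h x = x}"
          "{x \<in> P. \<forall>h\<in>H. \<psi> h x = x} \<subseteq> {x \<in> B. \<forall>h\<in>H. \<psi> h x = x}"
          using OA PB by auto
        moreover have "card {x \<in> O1. \<forall>h\<in>H. \<phi> h x = x} = card {x \<in> P. \<forall>h\<in>H. \<psi> h x = x}"
          by (rule card_fixed_eq[OF bij0]) (use eq0 H in auto)
        ultimately show ?thesis
          using mk[OF H] finA finB by (simp add: card_Diff_subset finite_subset)
      qed
      have "x \<in> O1" using finite_gset_one[OF S xS] one_closed by (force simp: O1_def \<phi>_def)
      then have "A - O1 \<subset> A" using x by auto
      then have "card (A - O1) < card A" using finA by (simp add: psubset_card_mono)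
      then have "\<exists>f. bij_betw f (A - O1) (B - P) \<and>
          (\<forall>g\<in>carrier G. \<forall>x\<in>A - O1. f (\<phi> g x) = \<psi> g (f x))"
        by (rule less.hyps[OF _ _ _ stA' stB' mk']) (use A B in auto)
      then obtain f1 where bij1: "bij_betw f1 (A - O1) (B - P)"
        and eq1: "\<And>g x. g \<in> carrier G \<Longrightarrow> x \<in> A - O1 \<Longrightarrow> f1 (\<phi> g x) = \<psi> g (f1 x)"
        by blast
      define f where "f z = (if z \<in> O1 then f0 z else f1 z)" for z
      have "bij_betw f (O1 \<union> (A - O1)) (P \<union> (B - P))"
        unfolding f_def by (rule bij_betw_disjoint_Un[OF bij0 bij1]) auto
      moreover have "f (\<phi> g z) = \<psi> g (f z)" if "g \<in> carrier G" "z \<in> A" for g z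
        using eq0[OF that(1), of z] eq1[OF that(1), of z] stA'[OF that(1), of z] that
        by (auto simp: f_def)
      ultimately show ?thesis using OA PB by (auto simp: Un_absorb1)
    qed
  qed
  from this[of "fst S" "fst T"] show ?thesis
    using finite_gset_closed[OF S] finite_gset_closed[OF T] marks
    by (simp add: gset_iso_def mark_def fixed_points_def \<phi>_def \<psi>_def)
qed

section \<open>The Burnside ring as a ring of marks\<close>

text \<open>The auxiliary summand \<open>U\<close> disappears: it cancels in the additive marks, and
  conversely equality of marks already gives an isomorphism, with the empty set as
  \<open>U\<close>.\<close>

lemma burnside_diff_eq:
  assumes S: "finite_gset G S" and T: "finite_gset G T"
  shows "burnside_diff G S T = {(A, B). finite_gset G A \<and> finite_gset G B \<and>
    (\<forall>H\<subseteq>carrier G. mark A H - mark B H = mark S H - mark T H)}"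
proof -
  have "(\<exists>U :: ('a, nat) gset. finite_gset G U \<and>
      gset_iso G (gset_sum (gset_sum S B) U) (gset_sum (gset_sum A T) U)) \<longleftrightarrow>
      (\<forall>H\<subseteq>carrier G. mark A H - mark B H = mark S H - mark T H)" (is "?L \<longleftrightarrow> ?R")
    if A: "finite_gset G A" and B: "finite_gset G B" for A B :: "('a, nat) gset"
  proof
    assume ?L
    then obtain U :: "('a, nat) gset" where U: "finite_gset G U"
      and iso: "gset_iso G (gset_sum (gset_sum S B) U) (gset_sum (gset_sum A T) U)" by blast
    show ?R
    proof (intro allI impI)
      fix H assume "H \<subseteq> carrier G"
      then have "mark (gset_sum (gset_sum S B) U) H = mark (gset_sum (gset_sum A T) U) H"
        using mark_iso[OF iso] S B U by (simp add: finite_gset_sum)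
      then show "mark A H - mark B H = mark S H - mark T H"
        using S T A B U by (simp add: mark_gset_sum[of G] finite_gset_sum)
    qed
  next
    assume R: ?R
    let ?U = "gset_empty :: ('a, nat) gset"
    have U: "finite_gset G ?U" using finite_gset_empty finite_gset_group[OF S] by blast
    have "gset_iso G (gset_sum (gset_sum S B) ?U) (gset_sum (gset_sum A T) ?U)"
    proof (rule gset_iso_of_marks)
      fix H assume "H \<subseteq> carrier G"
      with R have "mark A H - mark B H = mark S H - mark T H" by blast
      then show "mark (gset_sum (gset_sum S B) ?U) H = mark (gset_sum (gset_sum A T) ?U) H"
        using S T A B U by (simp add: mark_gset_sum[of G] finite_gset_sum)
    qed (use S T A B U in \<open>simp_all add: finite_gset_sum\<close>)
    then show ?L using U by blast
  qed
  then have "p \<in> burnside_diff G S T \<longleftrightarrow> p \<in> {(A, B). finite_gset G A \<and> finite_gset G B \<and>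
      (\<forall>H\<subseteq>carrier G. mark A H - mark B H = mark S H - mark T H)}" for p
    by (cases p) (simp only: burnside_diff_def mem_Collect_eq prod.case, blast)
  then show ?thesis by blast
qed

text \<open>All pairs in an element of the ring have the same difference of marks at each subset
  \<open>H\<close> of the group, so the choice is harmless there.\<close>

definition burnside_mark :: "'g burnside \<Rightarrow> 'g set \<Rightarrow> int"
  where "burnside_mark x H = (let (S, T) = (SOME p. p \<in> x) in mark S H - mark T H)"

lemma burnside_diff_nonempty:
  assumes S: "finite_gset G S" and T: "finite_gset G T"
  shows "burnside_diff G S T \<noteq> {}"
proof -
  obtain S' :: "('a, nat) gset" where S': "finite_gset G S'" "gset_iso G S' S"
    using ex_nat_gset[OF S] by blast
  obtain T' :: "('a, nat) gset" where T': "finite_gset G T'" "gset_iso G T' T"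
    using ex_nat_gset[OF T] by blast
  have "(S', T') \<in> burnside_diff G S T"
    using S' T' mark_iso[OF S'(2,1)] mark_iso[OF T'(2,1)] by (simp add: burnside_diff_eq[OF S T])
  then show ?thesis by auto
qed

lemma burnside_mark_diff:
  assumes S: "finite_gset G S" and T: "finite_gset G T" and H: "H \<subseteq> carrier G"
  shows "burnside_mark (burnside_diff G S T) H = mark S H - mark T H"
proof -
  have "(SOME p. p \<in> burnside_diff G S T) \<in> burnside_diff G S T"
    using burnside_diff_nonempty[OF S T] by (simp add: some_in_eq)
  then show ?thesis
    using H by (auto simp: burnside_mark_def burnside_diff_eq[OF S T] split: prod.splits)
qed

lemma burnside_diff_eqI:
  assumes "finite_gset G S" "finite_gset G T" "finite_gset G S'" "finite_gset G T'"
    and "\<And>H. H \<subseteq> carrier G \<Longrightarrow> mark S H - mark T H = mark S' H - mark T' H"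
  shows "burnside_diff G S T = burnside_diff G S' T'"
  using assms by (simp add: burnside_diff_eq)

lemma burnside_diff_closed:
  assumes S: "finite_gset G S" and T: "finite_gset G T"
  shows "burnside_diff G S T \<in> carrier (burnside_ring G)"
proof -
  obtain S' :: "('a, nat) gset" where S': "finite_gset G S'" "gset_iso G S' S"
    using ex_nat_gset[OF S] by blast
  obtain T' :: "('a, nat) gset" where T': "finite_gset G T'" "gset_iso G T' T"
    using ex_nat_gset[OF T] by blast
  have "burnside_diff G S T = burnside_diff G S' T'"
    using S' T' S T mark_iso[OF S'(2,1)] mark_iso[OF T'(2,1)] by (intro burnside_diff_eqI) auto
  moreover have "burnside_diff G S' T' \<in> carrier (burnside_ring G)"
    unfolding burnside_ring_def partial_object.simps using S'(1) T'(1) by blast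
  ultimately show ?thesis by simp
qed

lemma burnside_ringE:
  assumes "x \<in> carrier (burnside_ring G)"
  obtains S T :: "('g, nat) gset" where "finite_gset G S" "finite_gset G T" "x = burnside_diff G S T"
  using assms by (auto simp: burnside_ring_def)

text \<open>Injectivity of the mark map on the ring. Identities in the ring are reduced by it to
  identities of integers.\<close>

lemma burnside_ring_eqI:
  assumes "x \<in> carrier (burnside_ring G)" "y \<in> carrier (burnside_ring G)"
    and "\<And>H. H \<subseteq> carrier G \<Longrightarrow> burnside_mark x H = burnside_mark y H"
  shows "x = y"
  using assms(1)
proof (rule burnside_ringE)
  fix S T :: "('a, nat) gset"
  assume ST: "finite_gset G S" "finite_gset G T" "x = burnside_diff G S T"
  obtain S' T' :: "('a, nat) gset"
    where ST': "finite_gset G S'" "finite_gset G T'" "y = burnside_diff G S' T'"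
    using assms(2) by (rule burnside_ringE)
  show ?thesis
    unfolding ST(3) ST'(3)
    by (rule burnside_diff_eqI)
      (use ST ST' in \<open>simp_all add: assms(3)[unfolded ST(3) ST'(3)] flip: burnside_mark_diff\<close>)
qed

text \<open>The ring operations are unions over representatives. Once the result is independent of
  them, the union of the nonempty constant family is that result.\<close>

lemma UN_pair_const:
  assumes "x \<noteq> {}" "y \<noteq> {}" "\<And>S T S' T'. (S, T) \<in> x \<Longrightarrow> (S', T') \<in> y \<Longrightarrow> f S T S' T' = c"
  shows "(\<Union>(S, T)\<in>x. \<Union>(S', T')\<in>y. f S T S' T') = c"
  by (rule SUP_eq_const[OF assms(1)], clarify, rule SUP_eq_const[OF assms(2)], clarify)
    (rule assms(3))

section \<open>Addition and multiplication on formal differences\<close>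

lemma burnside_add_diff:
  fixes S T S' T' :: "('g, nat) gset"
  assumes "finite_gset G S" "finite_gset G T" "finite_gset G S'" "finite_gset G T'"
  shows "burnside_diff G S T \<oplus>\<^bsub>burnside_ring G\<^esub> burnside_diff G S' T' =
    burnside_diff G (gset_sum S S') (gset_sum T T')"
  unfolding burnside_ring_def ring.simps monoid.simps
proof (rule UN_pair_const)
  fix A B C D assume AB: "(A, B) \<in> burnside_diff G S T" "(C, D) \<in> burnside_diff G S' T'"
  then have fin: "finite_gset G A" "finite_gset G B" "finite_gset G C" "finite_gset G D"
    by (simp_all add: assms burnside_diff_eq)
  have "mark A H + mark C H - (mark B H + mark D H) = mark S H + mark S' H - (mark T H + mark T' H)"
    if "H \<subseteq> carrier G" for H
  proof -
    have "mark A H - mark B H = mark S H - mark T H" "mark C H - mark D H = mark S' H - mark T' H"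
      using AB that by (simp_all add: assms burnside_diff_eq)
    then show ?thesis by simp
  qed
  then show "burnside_diff G (gset_sum A C) (gset_sum B D) =
      burnside_diff G (gset_sum S S') (gset_sum T T')"
    using assms fin by (intro burnside_diff_eqI) (auto simp: mark_gset_sum[of G] finite_gset_sum)
qed (use assms in \<open>simp_all add: burnside_diff_nonempty\<close>)

lemma burnside_mult_diff:
  fixes S T S' T' :: "('g, nat) gset"
  assumes "finite_gset G S" "finite_gset G T" "finite_gset G S'" "finite_gset G T'"
  shows "burnside_diff G S T \<otimes>\<^bsub>burnside_ring G\<^esub> burnside_diff G S' T' =
    burnside_diff G (gset_sum (gset_prod S S') (gset_prod T T'))
      (gset_sum (gset_prod S T') (gset_prod T S'))"
  unfolding burnside_ring_def ring.simps monoid.simps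
proof (rule UN_pair_const)
  fix A B C D assume AB: "(A, B) \<in> burnside_diff G S T" "(C, D) \<in> burnside_diff G S' T'"
  then have fin: "finite_gset G A" "finite_gset G B" "finite_gset G C" "finite_gset G D"
    by (simp_all add: assms burnside_diff_eq)
  have "mark A H * mark C H + mark B H * mark D H - (mark A H * mark D H + mark B H * mark C H) =
     mark S H * mark S' H + mark T H * mark T' H - (mark S H * mark T' H + mark T H * mark S' H)"
    if "H \<subseteq> carrier G" for H
  proof -
    have "mark A H - mark B H = mark S H - mark T H" "mark C H - mark D H = mark S' H - mark T' H"
      using AB that by (simp_all add: assms burnside_diff_eq)
    \<comment> \<open>The mark of a product of differences is the product of the differences of
      marks; the goal is this equation multiplied out.\<close>
    then have "(mark A H - mark B H) * (mark C H - mark D H) =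
        (mark S H - mark T H) * (mark S' H - mark T' H)" by simp
    then show ?thesis by (simp add: algebra_simps)
  qed
  then show "burnside_diff G (gset_sum (gset_prod A C) (gset_prod B D))
        (gset_sum (gset_prod A D) (gset_prod B C)) =
      burnside_diff G (gset_sum (gset_prod S S') (gset_prod T T'))
        (gset_sum (gset_prod S T') (gset_prod T S'))"
    using assms fin
    by (intro burnside_diff_eqI)
      (auto simp: mark_gset_sum[of G] mark_gset_prod finite_gset_sum finite_gset_prod)
qed (use assms in \<open>simp_all add: burnside_diff_nonempty\<close>)

lemma burnside_add_closed:
  assumes "x \<in> carrier (burnside_ring G)" "y \<in> carrier (burnside_ring G)"
  shows "x \<oplus>\<^bsub>burnside_ring G\<^esub> y \<in> carrier (burnside_ring G)"
  using assms
  by (elim burnside_ringE) (auto simp: burnside_add_diff burnside_diff_closed finite_gset_sum)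

lemma burnside_mark_add:
  assumes "x \<in> carrier (burnside_ring G)" "y \<in> carrier (burnside_ring G)" "H \<subseteq> carrier G"
  shows "burnside_mark (x \<oplus>\<^bsub>burnside_ring G\<^esub> y) H = burnside_mark x H + burnside_mark y H"
  using assms
  by (elim burnside_ringE) (auto simp: burnside_add_diff burnside_mark_diff mark_gset_sum[of G] finite_gset_sum)

lemma burnside_mult_closed:
  assumes "x \<in> carrier (burnside_ring G)" "y \<in> carrier (burnside_ring G)"
  shows "x \<otimes>\<^bsub>burnside_ring G\<^esub> y \<in> carrier (burnside_ring G)"
  using assms
  by (elim burnside_ringE)
    (auto simp: burnside_mult_diff burnside_diff_closed finite_gset_sum finite_gset_prod)

lemma burnside_mark_mult:
  assumes "x \<in> carrier (burnside_ring G)" "y \<in> carrier (burnside_ring G)" "H \<subseteq> carrier G"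
  shows "burnside_mark (x \<otimes>\<^bsub>burnside_ring G\<^esub> y) H = burnside_mark x H * burnside_mark y H"
  using assms
  by (elim burnside_ringE)
    (auto simp: burnside_mult_diff burnside_mark_diff mark_gset_sum[of G] mark_gset_prod
      finite_gset_sum finite_gset_prod algebra_simps)

lemma burnside_class_closed:
  "finite_gset G S \<Longrightarrow> burnside_class G S \<in> carrier (burnside_ring G)"
  unfolding burnside_class_def
  by (intro burnside_diff_closed finite_gset_empty) (auto simp: finite_gset_group)

lemma burnside_mark_class:
  "finite_gset G S \<Longrightarrow> H \<subseteq> carrier G \<Longrightarrow> burnside_mark (burnside_class G S) H = mark S H"
  unfolding burnside_class_def
  by (subst burnside_mark_diff) (auto intro: finite_gset_empty finite_gset_group)

context group
begin

lemma burnside_zero_closed: "\<zero>\<^bsub>burnside_ring G\<^esub> \<in> carrier (burnside_ring G)"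
  using burnside_class_closed[OF finite_gset_empty[OF is_group]] by (simp add: burnside_ring_def)

lemma burnside_one_closed: "\<one>\<^bsub>burnside_ring G\<^esub> \<in> carrier (burnside_ring G)"
  using burnside_class_closed[OF finite_gset_point[OF is_group]] by (simp add: burnside_ring_def)

lemma burnside_mark_zero: "H \<subseteq> carrier G \<Longrightarrow> burnside_mark \<zero>\<^bsub>burnside_ring G\<^esub> H = 0"
  using burnside_mark_class[OF finite_gset_empty[OF is_group]] by (simp add: burnside_ring_def)

lemma burnside_mark_one: "H \<subseteq> carrier G \<Longrightarrow> burnside_mark \<one>\<^bsub>burnside_ring G\<^esub> H = 1"
  using burnside_mark_class[OF finite_gset_point[OF is_group]] by (simp add: burnside_ring_def)

lemma burnside_ring_cring: "cring (burnside_ring G)"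
proof (rule cringI)
  note simps = burnside_add_closed burnside_mult_closed burnside_zero_closed burnside_one_closed
    burnside_mark_add burnside_mark_mult burnside_mark_zero burnside_mark_one
  show "abelian_group (burnside_ring G)"
  proof (rule abelian_groupI)
    fix x assume x: "x \<in> carrier (burnside_ring G)"
    then obtain S T :: "('a, nat) gset" where *: "finite_gset G S" "finite_gset G T"
      "x = burnside_diff G S T" by (rule burnside_ringE)
    \<comment> \<open>The additive inverse of a formal difference swaps its two sets.\<close>
    have "burnside_diff G T S \<oplus>\<^bsub>burnside_ring G\<^esub> x = \<zero>\<^bsub>burnside_ring G\<^esub>"
      by (rule burnside_ring_eqI[of _ G])
        (use x * in \<open>simp_all add: simps burnside_diff_closed burnside_mark_diff\<close>)
    then show "\<exists>y\<in>carrier (burnside_ring G). y \<oplus>\<^bsub>burnside_ring G\<^esub> x = \<zero>\<^bsub>burnside_ring G\<^esub>"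
      using burnside_diff_closed[OF *(2,1)] by blast
  qed (simp_all add: simps, (rule burnside_ring_eqI[of _ G]; simp add: simps)+)
  show "comm_monoid (burnside_ring G)"
    by (rule comm_monoidI) (simp_all add: simps, (rule burnside_ring_eqI[of _ G]; simp add: simps)+)
  show "(x \<oplus>\<^bsub>burnside_ring G\<^esub> y) \<otimes>\<^bsub>burnside_ring G\<^esub> z =
      x \<otimes>\<^bsub>burnside_ring G\<^esub> z \<oplus>\<^bsub>burnside_ring G\<^esub> y \<otimes>\<^bsub>burnside_ring G\<^esub> z"
    if "x \<in> carrier (burnside_ring G)" "y \<in> carrier (burnside_ring G)" "z \<in> carrier (burnside_ring G)"
    for x y z
    by (rule burnside_ring_eqI[of _ G]) (use that in \<open>simp_all add: simps distrib_right\<close>)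
qed

end

section \<open>Power series over the Burnside ring\<close>

definition mark_series :: "(nat \<Rightarrow> 'g burnside) \<Rightarrow> 'g set \<Rightarrow> int fps"
  where "mark_series a H = Abs_fps (\<lambda>n. burnside_mark (a n) H)"

lemma mark_series_nth [simp]: "fps_nth (mark_series a H) n = burnside_mark (a n) H"
  by (simp add: mark_series_def)

text \<open>The quotient \<open>b / a\<close> by long division, for \<open>a\<close> with constant
  coefficient 1, so that only ring operations occur. The guard \<open>k < n\<close> repeats the
  index range inside the summand, where the termination argument can see it.\<close>

fun series_div :: "('r, 'm) ring_scheme \<Rightarrow> (nat \<Rightarrow> 'r) \<Rightarrow> (nat \<Rightarrow> 'r) \<Rightarrow> nat \<Rightarrow> 'r"
  where "series_div R b a n = b n \<ominus>\<^bsub>R\<^esub>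
    (\<Oplus>\<^bsub>R\<^esub>k\<in>{..<n}. if k < n then a (n - k) \<otimes>\<^bsub>R\<^esub> series_div R b a k else \<zero>\<^bsub>R\<^esub>)"

declare series_div.simps [simp del]

context group
begin

interpretation B: cring "burnside_ring G"
  by (rule burnside_ring_cring)

lemma burnside_mark_finsum:
  assumes "finite A" "f \<in> A \<rightarrow> carrier (burnside_ring G)" "H \<subseteq> carrier G"
  shows "burnside_mark (finsum (burnside_ring G) f A) H = (\<Sum>a\<in>A. burnside_mark (f a) H)"
  using assms by (induction A) (simp_all add: burnside_mark_zero burnside_mark_add B.finsum_closed)

lemma burnside_mark_a_inv:
  assumes "x \<in> carrier (burnside_ring G)" "H \<subseteq> carrier G"
  shows "burnside_mark (\<ominus>\<^bsub>burnside_ring G\<^esub> x) H = - burnside_mark x H"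
proof -
  have "burnside_mark (x \<oplus>\<^bsub>burnside_ring G\<^esub> \<ominus>\<^bsub>burnside_ring G\<^esub> x) H = 0"
    using assms by (simp add: B.r_neg burnside_mark_zero)
  then show ?thesis
    using assms by (simp add: burnside_mark_add)
qed

lemma burnside_mark_add_pow:
  assumes "x \<in> carrier (burnside_ring G)" "H \<subseteq> carrier G"
  shows "burnside_mark ([(k :: int)] \<cdot>\<^bsub>burnside_ring G\<^esub> x) H = k * burnside_mark x H"
proof -
  have nat: "burnside_mark ([(m :: nat)] \<cdot>\<^bsub>burnside_ring G\<^esub> x) H = int m * burnside_mark x H" for m
    using assms by (induction m) (simp_all add: burnside_mark_zero burnside_mark_add algebra_simps)
  show ?thesis
    using assms by (cases "k < 0") (simp_all add: add_pow_int_lt add_pow_int_ge burnside_mark_a_inv nat)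
qed

text \<open>The Burnside ring has zero divisors in general, but integer power series do not.
  Equalities of series are therefore proved at each \<open>H\<close>, where nonzero factors
  cancel.\<close>

lemma series_eqI:
  assumes "a \<in> UNIV \<rightarrow> carrier (burnside_ring G)" "b \<in> UNIV \<rightarrow> carrier (burnside_ring G)"
    and "\<And>H. H \<subseteq> carrier G \<Longrightarrow> mark_series a H = mark_series b H"
  shows "a = b"
proof
  fix n
  have "burnside_mark (a n) H = burnside_mark (b n) H" if "H \<subseteq> carrier G" for H
    using assms(3)[OF that] by (metis mark_series_nth)
  then show "a n = b n" using burnside_ring_eqI[of "a n" G "b n"] assms by auto
qed

lemma series_mult_closed:
  assumes "a \<in> UNIV \<rightarrow> carrier (burnside_ring G)" "b \<in> UNIV \<rightarrow> carrier (burnside_ring G)"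
  shows "series_mult (burnside_ring G) a b \<in> UNIV \<rightarrow> carrier (burnside_ring G)"
  using assms by (auto simp: series_mult_def Pi_iff intro!: B.finsum_closed)

lemma mark_series_mult:
  assumes "a \<in> UNIV \<rightarrow> carrier (burnside_ring G)" "b \<in> UNIV \<rightarrow> carrier (burnside_ring G)"
    and "H \<subseteq> carrier G"
  shows "mark_series (series_mult (burnside_ring G) a b) H = mark_series a H * mark_series b H"
proof (rule fps_ext)
  fix n
  have "(\<lambda>k. a k \<otimes>\<^bsub>burnside_ring G\<^esub> b (n - k)) \<in> {..n} \<rightarrow> carrier (burnside_ring G)"
    using assms by (auto simp: Pi_iff)
  then show "fps_nth (mark_series (series_mult (burnside_ring G) a b) H) n =
      fps_nth (mark_series a H * mark_series b H) n"
    using assms by (simp add: series_mult_def burnside_mark_finsum burnside_mark_mult Pi_iff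
        fps_mult_nth atLeast0AtMost)
qed

lemma series_one_closed: "series_one (burnside_ring G) \<in> UNIV \<rightarrow> carrier (burnside_ring G)"
  by (simp add: series_one_def)

lemma mark_series_one: "H \<subseteq> carrier G \<Longrightarrow> mark_series (series_one (burnside_ring G)) H = 1"
  by (rule fps_ext) (simp add: series_one_def burnside_mark_zero burnside_mark_one)

lemma series_neg_arg_closed:
  "a \<in> UNIV \<rightarrow> carrier (burnside_ring G) \<Longrightarrow>
    series_neg_arg (burnside_ring G) a \<in> UNIV \<rightarrow> carrier (burnside_ring G)"
  by (auto simp: series_neg_arg_def Pi_iff)

lemma series_div_closed:
  assumes "a \<in> UNIV \<rightarrow> carrier (burnside_ring G)" "b \<in> UNIV \<rightarrow> carrier (burnside_ring G)"
  shows "series_div (burnside_ring G) b a \<in> UNIV \<rightarrow> carrier (burnside_ring G)"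
proof -
  have "series_div (burnside_ring G) b a n \<in> carrier (burnside_ring G)" for n
  proof (induction n rule: less_induct)
    case (less n)
    then show ?case
      using assms by (subst series_div.simps) (auto simp: Pi_iff intro!: B.minus_closed B.finsum_closed)
  qed
  then show ?thesis by auto
qed

lemma mark_series_div:
  assumes a: "a \<in> UNIV \<rightarrow> carrier (burnside_ring G)" and b: "b \<in> UNIV \<rightarrow> carrier (burnside_ring G)"
    and H: "H \<subseteq> carrier G" and a0: "a 0 = \<one>\<^bsub>burnside_ring G\<^esub>"
  shows "mark_series (series_div (burnside_ring G) b a) H * mark_series a H = mark_series b H"
proof (rule fps_ext)
  fix n
  let ?c = "series_div (burnside_ring G) b a"
  let ?f = "\<lambda>k. if k < n then a (n - k) \<otimes>\<^bsub>burnside_ring G\<^esub> ?c k else \<zero>\<^bsub>burnside_ring G\<^esub>"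
  have c: "?c k \<in> carrier (burnside_ring G)" for k
    using series_div_closed[OF a b] by auto
  have f: "?f \<in> {..<n} \<rightarrow> carrier (burnside_ring G)"
    using a c by (auto simp: Pi_iff)
  have "burnside_mark (?c n) H = burnside_mark (b n) H -
      burnside_mark (finsum (burnside_ring G) ?f {..<n}) H"
    using B.finsum_closed[OF f] b H
    by (subst series_div.simps) (auto simp: a_minus_def burnside_mark_add burnside_mark_a_inv Pi_iff)
  also have "burnside_mark (finsum (burnside_ring G) ?f {..<n}) H = (\<Sum>k<n. burnside_mark (?f k) H)"
    by (rule burnside_mark_finsum[OF _ f H]) simp
  also have "\<dots> = (\<Sum>k<n. burnside_mark (?c k) H * burnside_mark (a (n - k)) H)"
    using a c H by (intro sum.cong) (auto simp: burnside_mark_mult Pi_iff)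
  \<comment> \<open>As \<open>a 0\<close> is the unit, the term \<open>k = n\<close> of the
    convolution is the new coefficient itself.\<close>
  finally have "burnside_mark (b n) H = (\<Sum>k\<le>n. burnside_mark (?c k) H * burnside_mark (a (n - k)) H)"
    using a0 H by (simp add: burnside_mark_one flip: lessThan_Suc_atMost)
  then show "fps_nth (mark_series ?c H * mark_series a H) n = fps_nth (mark_series b H) n"
    by (simp add: fps_mult_nth atLeast0AtMost)
qed

end

section \<open>Symmetric powers\<close>

text \<open>A concrete model of the symmetric power, in which invariance under \<open>H\<close> is a
  condition on one multiset instead of on an orbit of tuples.\<close>

definition mset_gset :: "nat \<Rightarrow> ('g, 'a) gset \<Rightarrow> ('g, 'a multiset) gset"
  where "mset_gset n S =
    (multisets_of_size (fst S) n, \<lambda>g. \<lambda>M\<in>multisets_of_size (fst S) n. image_mset (snd S g) M)"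

lemma mem_multisets_of_size: "M \<in> multisets_of_size A n \<longleftrightarrow> set_mset M \<subseteq> A \<and> size M = n"
  by (simp add: multisets_of_size_def)

lemma finite_mset_gset:
  assumes S: "finite_gset G S"
  shows "finite_gset G (mset_gset n S)"
proof (rule finite_gsetI)
  show "group G" using S by (rule finite_gset_group)
  show "finite (fst (mset_gset n S))"
    using finite_gset_finite[OF S] by (simp add: mset_gset_def finite_multisets_of_size)
  have cl: "image_mset (snd S g) M \<in> multisets_of_size (fst S) n"
    if "g \<in> carrier G" "M \<in> multisets_of_size (fst S) n" for g M
    using that finite_gset_closed[OF S that(1)] by (auto simp: mem_multisets_of_size)
  show "snd (mset_gset n S) g \<in> fst (mset_gset n S) \<rightarrow>\<^sub>E fst (mset_gset n S)"
    if "g \<in> carrier G" for g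
    using cl that by (auto simp: mset_gset_def)
  interpret group G by fact
  show "snd (mset_gset n S) \<one>\<^bsub>G\<^esub> M = M" if "M \<in> fst (mset_gset n S)" for M
  proof -
    have "image_mset (snd S \<one>\<^bsub>G\<^esub>) M = image_mset id M"
      using that finite_gset_one[OF S] by (intro image_mset_cong) (auto simp: mset_gset_def mem_multisets_of_size)
    then show ?thesis using that by (simp add: mset_gset_def)
  qed
  show "snd (mset_gset n S) (g \<otimes>\<^bsub>G\<^esub> h) M = snd (mset_gset n S) g (snd (mset_gset n S) h M)"
    if "g \<in> carrier G" "h \<in> carrier G" "M \<in> fst (mset_gset n S)" for g h M
  proof -
    have "image_mset (snd S (g \<otimes>\<^bsub>G\<^esub> h)) M = image_mset (snd S g \<circ> snd S h) M"
      using that finite_gset_mult[OF S] by (intro image_mset_cong) (auto simp: mset_gset_def mem_multisets_of_size)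
    then show ?thesis using that cl by (simp add: mset_gset_def multiset.map_comp)
  qed
qed

text \<open>The orbit of a tuple under permutations of its positions is determined by the multiset of its entries.\<close>

lemma sym_power_mset_bij:
  fixes S :: "('g, 'a) gset"
  assumes S: "finite_gset G S"
  obtains F where "bij_betw F (fst (gset_sym_power n S)) (fst (mset_gset n S))"
    "\<And>g c. g \<in> carrier G \<Longrightarrow> c \<in> fst (gset_sym_power n S) \<Longrightarrow>
      snd (gset_sym_power n S) g c \<in> fst (gset_sym_power n S) \<and>
      F (snd (gset_sym_power n S) g c) = snd (mset_gset n S) g (F c)"
proof -
  \<comment> \<open>\<open>q f\<close> is the orbit of the tuple \<open>f\<close>,
    \<open>m f\<close> the multiset of its entries; the bijection is to send \<open>q f\<close> to
    \<open>m f\<close>.\<close>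
  define q where "q f = (\<lambda>\<pi>. f \<circ> inv' \<pi>) ` {\<pi>. \<pi> permutes {1..n}}" for f :: "nat \<Rightarrow> 'a"
  define m where "m f = image_mset f (mset_set {1..n})" for f :: "nat \<Rightarrow> 'a"
  define F where "F c = m (SOME f. f \<in> c)" for c
  let ?T = "{1..n} \<rightarrow>\<^sub>E fst S"
  have Q: "fst (gset_sym_power n S) = q ` ?T"
    by (auto simp: gset_sym_power_def orbits_def orbit_def sym_group_carrier q_def Let_def Setcompr_eq_image)
  have self: "f \<in> q f" for f
    unfolding q_def by (rule image_eqI[of _ _ id]) (simp_all add: permutes_id)
  have m_comp: "m (f \<circ> inv' \<pi>) = m f" if "\<pi> permutes {1..n}" for f \<pi>
  proof -
    have "image_mset (inv' \<pi>) (mset_set {1..n}) = mset_set {1..n}"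
      using permutes_inv[OF that] by (simp add: image_mset_mset_set permutes_inj_on permutes_image)
    then show ?thesis unfolding m_def by (simp flip: multiset.map_comp)
  qed
  have q_mono: "q f \<subseteq> q f'" if "f \<in> q f'" for f f'
  proof
    fix u assume "u \<in> q f"
    then obtain \<pi> where \<pi>: "\<pi> permutes {1..n}" "u = f \<circ> inv' \<pi>" by (auto simp: q_def)
    from that obtain \<rho> where \<rho>: "\<rho> permutes {1..n}" "f = f' \<circ> inv' \<rho>" by (auto simp: q_def)
    have "inv' (\<pi> \<circ> \<rho>) = inv' \<rho> \<circ> inv' \<pi>"
      using \<pi> \<rho> by (simp add: o_inv_distrib permutes_bij)
    then have "u = f' \<circ> inv' (\<pi> \<circ> \<rho>)" using \<pi> \<rho> by (simp add: comp_assoc)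
    then show "u \<in> q f'" unfolding q_def using permutes_compose[OF \<rho>(1) \<pi>(1)] by blast
  qed
  have q_mem: "f \<in> q f'" if f: "f \<in> ?T" and f': "f' \<in> ?T" and eq: "m f = m f'" for f f'
  proof -
    obtain p where p: "p permutes {1..n}" "\<forall>x\<in>{1..n}. f x = f' (p x)"
      using image_mset_eq_implies_permutes[of "{1..n}" f f'] eq unfolding m_def by auto
    \<comment> \<open>Outside \<open>{1..n}\<close> both tuples are undefined and \<open>p\<close>
      is the identity, so the equation holds everywhere.\<close>
    have "f = f' \<circ> p"
    proof
      fix x show "f x = (f' \<circ> p) x"
      proof (cases "x \<in> {1..n}")
        case False
        then have "p x = x" using p(1) by (auto simp: permutes_def)
        with False show ?thesis using PiE_arb[OF f False] PiE_arb[OF f' False] by simp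
      qed (use p(2) in simp)
    qed
    \<comment> \<open>Positions are permuted by composing with an inverse, so \<open>p\<close> has
      to be exhibited as one.\<close>
    also have "p = inv' (inv' p)" using permutes_bij[OF p(1)] by (rule inv_inv_eq[symmetric])
    finally have "f = f' \<circ> inv' (inv' p)" .
    then show ?thesis unfolding q_def using permutes_inv[OF p(1)] by blast
  qed
  have q_eq: "q f = q f' \<longleftrightarrow> m f = m f'" if "f \<in> ?T" "f' \<in> ?T" for f f'
  proof
    assume "q f = q f'"
    then have "f \<in> q f'" using self[of f] by simp
    then show "m f = m f'" using m_comp by (auto simp: q_def)
  next
    assume "m f = m f'"
    then show "q f = q f'" using q_mem[OF that] q_mem[OF that(2,1)] q_mono by (metis subset_antisym)
  qed
  have Fq: "F (q f) = m f" for f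
  proof -
    have "(SOME u. u \<in> q f) \<in> q f" by (rule someI[of _ f]) (rule self)
    then show ?thesis using m_comp by (auto simp: F_def q_def)
  qed
  have m_surj: "m ` ?T = multisets_of_size (fst S) n"
  proof (intro equalityI subsetI)
    fix M assume "M \<in> m ` ?T"
    then show "M \<in> multisets_of_size (fst S) n" by (auto simp: m_def mem_multisets_of_size)
  next
    fix M assume M: "M \<in> multisets_of_size (fst S) n"
    obtain xs where xs: "mset xs = M" using ex_mset by blast
    then have len: "length xs = n" and sub: "set xs \<subseteq> fst S"
      using M by (auto simp: mem_multisets_of_size)
    \<comment> \<open>Tuples are indexed from 1, lists from 0.\<close>
    define f where "f = (\<lambda>j\<in>{1..n}. xs ! (j - 1))"
    have "f \<in> ?T" using len sub by (force simp: f_def)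
    moreover have "m f = M"
    proof -
      have "mset_set {1..n} = image_mset Suc (mset_set {0..<n})"
        by (simp add: image_mset_mset_set image_Suc_atLeastLessThan atLeastLessThanSuc_atLeastAtMost)
      then have "m f = image_mset (\<lambda>j. f (Suc j)) (mset_set {0..<n})"
        by (simp add: m_def multiset.map_comp comp_def)
      also have "\<dots> = image_mset ((!) xs) (mset_set {0..<n})"
        by (intro image_mset_cong) (auto simp: f_def)
      also have "\<dots> = mset (map ((!) xs) [0..<n])"
        by (simp flip: mset_upt)
      also have "\<dots> = M" using xs len map_nth[of xs] by simp
      finally show ?thesis .
    qed
    ultimately show "M \<in> m ` ?T" by blast
  qed
  have bij: "bij_betw F (q ` ?T) (multisets_of_size (fst S) n)"
    unfolding bij_betw_def
  proof
    show "inj_on F (q ` ?T)" using q_eq by (auto simp: inj_on_def Fq)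
    show "F ` q ` ?T = multisets_of_size (fst S) n" using m_surj by (simp add: image_image Fq)
  qed
  have "snd (gset_sym_power n S) g c \<in> fst (gset_sym_power n S) \<and>
      F (snd (gset_sym_power n S) g c) = snd (mset_gset n S) g (F c)"
    if g: "g \<in> carrier G" and c: "c \<in> fst (gset_sym_power n S)" for g c
  proof -
    from c obtain f where f: "f \<in> ?T" "c = q f" by (auto simp: Q)
    define gf where "gf = (\<lambda>j\<in>{1..n}. snd S g (f j))"
    have gfT: "gf \<in> ?T" using f(1) finite_gset_closed[OF S g] by (auto simp: gf_def)
    \<comment> \<open>The group acts on entries and the permutation on positions, so they commute.
      For \<open>j\<close> outside \<open>{1..n}\<close> both sides are undefined, as
      \<open>inv' \<pi>\<close> preserves the index set.\<close>
    have *: "(\<lambda>j\<in>{1..n}. snd S g ((f \<circ> inv' \<pi>) j)) = gf \<circ> inv' \<pi>" if "\<pi> permutes {1..n}" for \<pi>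
    proof
      fix j
      have "inv' \<pi> j \<in> {1..n} \<longleftrightarrow> j \<in> {1..n}"
        using permutes_in_image[OF permutes_inv[OF that]] .
      then show "(\<lambda>j\<in>{1..n}. snd S g ((f \<circ> inv' \<pi>) j)) j = (gf \<circ> inv' \<pi>) j"
        by (simp add: gf_def restrict_def)
    qed
    have "snd (gset_sym_power n S) g c = (\<lambda>u. \<lambda>j\<in>{1..n}. snd S g (u j)) ` q f"
      using c unfolding f(2) gset_sym_power_def Let_def by simp
    also have "\<dots> = q gf"
      unfolding q_def image_image by (rule image_cong) (use * in auto)
    finally have eq: "snd (gset_sym_power n S) g c = q gf" .
    have "m gf = image_mset (snd S g) (m f)"
      unfolding m_def gf_def multiset.map_comp by (rule image_mset_cong) simp
    moreover have "m f \<in> multisets_of_size (fst S) n" using m_surj f(1) by blast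
    ultimately show ?thesis
      using gfT unfolding f(2) eq[unfolded f(2)] Q Fq by (simp add: mset_gset_def)
  qed
  then show ?thesis
    using that[of F] bij by (auto simp: Q mset_gset_def)
qed

lemma gset_sym_power_iso:
  assumes S: "finite_gset G S"
  shows "gset_iso G (gset_sym_power n S) (mset_gset n S)"
    and "finite_gset G (gset_sym_power n S)"
proof -
  obtain F where F: "bij_betw F (fst (gset_sym_power n S)) (fst (mset_gset n S))"
    and eq: "\<And>g c. g \<in> carrier G \<Longrightarrow> c \<in> fst (gset_sym_power n S) \<Longrightarrow>
      snd (gset_sym_power n S) g c \<in> fst (gset_sym_power n S) \<and>
      F (snd (gset_sym_power n S) g c) = snd (mset_gset n S) g (F c)"
    using sym_power_mset_bij[OF S] by metis
  show "gset_iso G (gset_sym_power n S) (mset_gset n S)"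
    using F eq by (auto simp: gset_iso_def)
  have "snd (gset_sym_power n S) g \<in> fst (gset_sym_power n S) \<rightarrow>\<^sub>E fst (gset_sym_power n S)"
    if "g \<in> carrier G" for g
    using eq[OF that] by (auto simp: gset_sym_power_def Let_def)
  then show "finite_gset G (gset_sym_power n S)"
    using finite_gset_transport[OF finite_mset_gset[OF S] F] eq by blast
qed

lemma mark_sym_power:
  assumes S: "finite_gset G S" and H: "H \<subseteq> carrier G"
  shows "mark (gset_sym_power n S) H = mark (mset_gset n S) H"
  using mark_iso[OF gset_sym_power_iso[OF S] H] .

section \<open>Marks of multiset powers: invariance under isomorphism and the sum formula\<close>

lemma fixed_mset_gset:
  "fixed_points (mset_gset n S) H =
    {M \<in> multisets_of_size (fst S) n. \<forall>h\<in>H. image_mset (snd S h) M = M}"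
  by (auto simp: fixed_points_def mset_gset_def)

lemma mark_mset_gset_cong:
  assumes "gset_iso G S T" and S: "finite_gset G S" and H: "H \<subseteq> carrier G"
  shows "mark (mset_gset n S) H = mark (mset_gset n T) H"
proof -
  from assms(1) obtain f where f: "bij_betw f (fst S) (fst T)"
    and eq: "\<And>g x. g \<in> carrier G \<Longrightarrow> x \<in> fst S \<Longrightarrow> f (snd S g x) = snd T g (f x)"
    by (auto simp: gset_iso_def)
  let ?f' = "inv_into (fst S) f"
  have im: "image_mset ?f' (image_mset f M) = M" if "set_mset M \<subseteq> fst S" for M
  proof -
    have "image_mset (?f' \<circ> f) M = image_mset id M"
      using f that by (intro image_mset_cong) (auto simp: bij_betw_inv_into_left)
    then show ?thesis by (simp add: multiset.map_comp)
  qed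
  have im': "image_mset f (image_mset ?f' M) = M" if "set_mset M \<subseteq> fst T" for M
  proof -
    have "image_mset (f \<circ> ?f') M = image_mset id M"
      using f that by (intro image_mset_cong) (auto simp: bij_betw_inv_into_right)
    then show ?thesis by (simp add: multiset.map_comp)
  qed
  have bij: "bij_betw (image_mset f) (multisets_of_size (fst S) n) (multisets_of_size (fst T) n)"
    using f im im' bij_betw_apply[OF f] bij_betw_apply[OF bij_betw_inv_into[OF f]]
    by (intro bij_betw_byWitness[where f' = "image_mset ?f'"])
      (auto simp: mem_multisets_of_size subset_iff)
  have "image_mset (snd S h) M \<in> multisets_of_size (fst S) n \<and>
      image_mset f (image_mset (snd S h) M) = image_mset (snd T h) (image_mset f M)"
    if "h \<in> H" "M \<in> multisets_of_size (fst S) n" for h M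
  proof
    have h: "h \<in> carrier G" using that H by auto
    show "image_mset (snd S h) M \<in> multisets_of_size (fst S) n"
      using that finite_gset_closed[OF S h] by (auto simp: mem_multisets_of_size)
    have "image_mset (f \<circ> snd S h) M = image_mset (snd T h \<circ> f) M"
      using that eq[OF h] by (intro image_mset_cong) (auto simp: mem_multisets_of_size)
    then show "image_mset f (image_mset (snd S h) M) = image_mset (snd T h) (image_mset f M)"
      by (simp add: multiset.map_comp)
  qed
  from card_fixed_eq[where H = H and \<phi> = "\<lambda>h. image_mset (snd S h)"
      and \<psi> = "\<lambda>h. image_mset (snd T h)", OF bij this]
  show ?thesis by (simp add: mark_def fixed_mset_gset)
qed

text \<open>A multiset on a disjoint union is a left and a right multiset, and the action respects
  this splitting. Sorting by the size of the left part gives the convolution.\<close>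

lemma mark_mset_gset_sum:
  fixes S :: "('g, 'a) gset" and T :: "('g, 'b) gset"
  assumes S: "finite_gset G S" and T: "finite_gset G T" and H: "H \<subseteq> carrier G"
  shows "mark (mset_gset n (gset_sum S T)) H =
    (\<Sum>k\<le>n. mark (mset_gset k S) H * mark (mset_gset (n - k) T) H)"
proof -
  let ?F = "\<lambda>k. fixed_points (mset_gset k S) H \<times> fixed_points (mset_gset (n - k) T) H"
  let ?j = "\<lambda>(M, N). image_mset Inl M + image_mset Inr N"
  define l where "l M = image_mset projl (filter_mset isl M)" for M :: "('a + 'b) multiset"
  define r where "r M = image_mset projr (filter_mset (\<lambda>x. \<not> isl x) M)" for M :: "('a + 'b) multiset"
  have l: "l (image_mset Inl M + image_mset Inr N) = M" and r: "r (image_mset Inl M + image_mset Inr N) = N"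
    for M :: "'a multiset" and N :: "'b multiset"
    by (simp_all add: l_def r_def filter_mset_image_mset multiset.map_comp comp_def)
  have lr: "image_mset Inl (l M) + image_mset Inr (r M) = M" for M
  proof -
    have "image_mset (Inl \<circ> projl) (filter_mset isl M) = image_mset id (filter_mset isl M)"
      "image_mset (Inr \<circ> projr) (filter_mset (\<lambda>x. \<not> isl x) M) = image_mset id (filter_mset (\<lambda>x. \<not> isl x) M)"
      by (intro image_mset_cong; simp)+
    then show ?thesis
      using multiset_partition[of M isl] by (simp add: l_def r_def multiset.map_comp)
  qed
  have size: "size (l M) + size (r M) = size M" for M
    using arg_cong[OF lr[of M], of size] by simp
  have set_l: "x \<in># l M \<longleftrightarrow> Inl x \<in># M" and set_r: "y \<in># r M \<longleftrightarrow> Inr y \<in># M" for x y M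
    using arg_cong[OF lr[of M], of set_mset] by auto
  have act: "image_mset (snd (gset_sum S T) h) M =
      image_mset Inl (image_mset (snd S h) (l M)) + image_mset Inr (image_mset (snd T h) (r M))"
    if "set_mset M \<subseteq> fst S <+> fst T" for M h
  proof -
    have "image_mset (snd (gset_sum S T) h) (image_mset Inl (l M)) =
        image_mset Inl (image_mset (snd S h) (l M))"
      "image_mset (snd (gset_sum S T) h) (image_mset Inr (r M)) =
        image_mset Inr (image_mset (snd T h) (r M))"
      unfolding multiset.map_comp using that
      by (auto intro!: image_mset_cong simp: gset_sum_def set_l set_r)
    then show ?thesis
      using arg_cong[OF lr[of M], of "image_mset (snd (gset_sum S T) h)"] by simp
  qed
  \<comment> \<open>Both sides are joined from their left and right parts, and \<open>l\<close> and
    \<open>r\<close> recover the parts, so they can be compared separately.\<close>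
  have fix_iff: "image_mset (snd (gset_sum S T) h) M = M \<longleftrightarrow>
      image_mset (snd S h) (l M) = l M \<and> image_mset (snd T h) (r M) = r M"
    if "set_mset M \<subseteq> fst S <+> fst T" for M h
    unfolding act[OF that] using l r lr by metis
  define U where "U = (\<Union>k\<le>n. ?F k)"
  have mem: "M \<in> fixed_points (mset_gset n (gset_sum S T)) H \<longleftrightarrow> (l M, r M) \<in> U" for M
  proof -
    have "set_mset M \<subseteq> fst S <+> fst T \<longleftrightarrow> set_mset (l M) \<subseteq> fst S \<and> set_mset (r M) \<subseteq> fst T"
    proof -
      have "set_mset M = Inl ` set_mset (l M) \<union> Inr ` set_mset (r M)"
        using arg_cong[OF lr[of M], of set_mset] by simp
      then show ?thesis by (auto simp: Plus_def)
    qed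
    then show ?thesis
      using fix_iff[of M] size[of M]
      by (auto simp: U_def fixed_mset_gset mem_multisets_of_size gset_sum_def)
  qed
  have "bij_betw ?j U (fixed_points (mset_gset n (gset_sum S T)) H)"
  proof (rule bij_betw_byWitness[where f' = "\<lambda>M. (l M, r M)"])
    show "\<forall>p\<in>U. (\<lambda>M. (l M, r M)) (?j p) = p" by (simp add: l r split: prod.split)
    show "\<forall>M\<in>fixed_points (mset_gset n (gset_sum S T)) H. ?j (l M, r M) = M" by (simp add: lr)
    show "?j ` U \<subseteq> fixed_points (mset_gset n (gset_sum S T)) H"
    proof clarify
      fix M N assume "(M, N) \<in> U"
      then show "image_mset Inl M + image_mset Inr N \<in> fixed_points (mset_gset n (gset_sum S T)) H"
        unfolding mem l r .
    qed
    show "(\<lambda>M. (l M, r M)) ` fixed_points (mset_gset n (gset_sum S T)) H \<subseteq> U"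
      using mem by blast
  qed
  then have "card (fixed_points (mset_gset n (gset_sum S T)) H) = card U"
    by (simp add: bij_betw_same_card)
  also have "card U = (\<Sum>k\<le>n. card (?F k))"
    unfolding U_def
  proof (rule card_UN_disjoint)
    show "\<forall>k\<in>{..n}. finite (?F k)"
      using finite_fixed_points[OF finite_mset_gset[OF S]] finite_fixed_points[OF finite_mset_gset[OF T]]
      by simp
    show "\<forall>i\<in>{..n}. \<forall>j\<in>{..n}. i \<noteq> j \<longrightarrow> ?F i \<inter> ?F j = {}"
      by (auto simp: fixed_mset_gset mem_multisets_of_size)
  qed simp
  finally show ?thesis by (simp add: mark_def card_cartesian_product)
qed

lemma mark_mset_gset_0: "mark (mset_gset 0 S) H = 1"
proof -
  have "fixed_points (mset_gset 0 S) H = {{#}}" by (auto simp: fixed_mset_gset mem_multisets_of_size)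
  then show ?thesis by (simp add: mark_def)
qed

lemma mark_mset_gset_empty:
  assumes "0 < n"
  shows "mark (mset_gset n (gset_empty :: ('g, 'a) gset)) H = 0"
proof -
  have "fixed_points (mset_gset n (gset_empty :: ('g, 'a) gset)) H = {}"
    using assms by (auto simp: fixed_mset_gset mem_multisets_of_size gset_empty_def)
  then show ?thesis by (simp add: mark_def)
qed

section \<open>The operations \<open>\<sigma>\<close> and \<open>\<lambda>\<close>\<close>

lemma mark_series_sym_power:
  assumes S: "finite_gset G S" and H: "H \<subseteq> carrier G"
  shows "mark_series (\<lambda>n. burnside_class G (gset_sym_power n S)) H =
    Abs_fps (\<lambda>n. mark (mset_gset n S) H)"
  using gset_sym_power_iso(2)[OF S] mark_sym_power[OF S H] H
  by (simp add: mark_series_def burnside_mark_class)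

lemma mset_gset_series_sum:
  assumes "finite_gset G S" "finite_gset G T" "H \<subseteq> carrier G"
  shows "Abs_fps (\<lambda>n. mark (mset_gset n (gset_sum S T)) H) =
    Abs_fps (\<lambda>n. mark (mset_gset n S) H) * Abs_fps (\<lambda>n. mark (mset_gset n T) H)"
  by (rule fps_ext) (simp add: mark_mset_gset_sum[OF assms] fps_mult_nth atLeast0AtMost)

text \<open>The constant coefficient is 1, for the empty multiset. This licenses all cancellations
  below.\<close>

lemma mset_gset_series_nonzero: "Abs_fps (\<lambda>n. mark (mset_gset n S) H) \<noteq> 0"
  by (metis fps_nth_Abs_fps fps_zero_nth mark_mset_gset_0 zero_neq_one)

text \<open>The quotient of the series of \<open>S\<close> and \<open>T\<close> depends only on the
  formal difference, here in cross-multiplied form. Equal differences of marks give equal marks of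
  \<open>gset_sum S T'\<close> and \<open>gset_sum S' T\<close>, hence an isomorphism, which passes
  to multisets.\<close>

lemma mset_gset_series_diff_eq:
  assumes "finite_gset G S" "finite_gset G T" "finite_gset G S'" "finite_gset G T'"
    and eq: "burnside_diff G S T = burnside_diff G S' T'" and H: "H \<subseteq> carrier G"
  shows "Abs_fps (\<lambda>n. mark (mset_gset n S) H) * Abs_fps (\<lambda>n. mark (mset_gset n T') H) =
    Abs_fps (\<lambda>n. mark (mset_gset n S') H) * Abs_fps (\<lambda>n. mark (mset_gset n T) H)"
proof -
  have "mark S K - mark T K = mark S' K - mark T' K" if "K \<subseteq> carrier G" for K
    using burnside_mark_diff[OF assms(1,2) that] burnside_mark_diff[OF assms(3,4) that] eq by simp
  then have "gset_iso G (gset_sum S T') (gset_sum S' T)"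
    using assms(1-4)
    by (intro gset_iso_of_marks) (simp_all add: finite_gset_sum mark_gset_sum[of G] algebra_simps)
  then have "mark (mset_gset n (gset_sum S T')) H = mark (mset_gset n (gset_sum S' T)) H" for n
    using mark_mset_gset_cong H assms(1-4) finite_gset_sum by blast
  then show ?thesis
    using mset_gset_series_sum[of G S T' H] mset_gset_series_sum[of G S' T H] assms by simp
qed

section \<open>Existence and uniqueness of the sigma and lambda series\<close>

context group
begin

text \<open>The condition inside the description of \<open>burnside_sigma_series\<close>, named so
  that existence and uniqueness can be stated separately.\<close>

definition sigma_property :: "('a burnside \<Rightarrow> nat \<Rightarrow> 'a burnside) \<Rightarrow> bool"
  where "sigma_property s \<longleftrightarrow>
    s \<in> carrier (burnside_ring G) \<rightarrow>\<^sub>E (UNIV \<rightarrow> carrier (burnside_ring G)) \<and>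
    (\<forall>S :: ('a, nat) gset. finite_gset G S \<longrightarrow>
      (\<forall>n. s (burnside_class G S) n = burnside_class G (gset_sym_power n S))) \<and>
    (\<forall>x\<in>carrier (burnside_ring G). \<forall>y\<in>carrier (burnside_ring G).
      s (x \<oplus>\<^bsub>burnside_ring G\<^esub> y) = series_mult (burnside_ring G) (s x) (s y))"

lemma sigma_property_class:
  assumes "sigma_property s" "finite_gset G (S :: ('a, nat) gset)"
  shows "s (burnside_class G S) = (\<lambda>n. burnside_class G (gset_sym_power n S))"
  using assms unfolding sigma_property_def by blast

lemma sym_power_0:
  assumes S: "finite_gset G S"
  shows "burnside_class G (gset_sym_power 0 S) = \<one>\<^bsub>burnside_ring G\<^esub>"
  by (rule burnside_ring_eqI[of _ G])
    (use S in \<open>simp_all add: burnside_class_closed gset_sym_power_iso burnside_one_closed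
      burnside_mark_one burnside_mark_class mark_sym_power mark_mset_gset_0\<close>)

lemma sym_power_closed:
  "finite_gset G S \<Longrightarrow>
    (\<lambda>n. burnside_class G (gset_sym_power n S)) \<in> UNIV \<rightarrow> carrier (burnside_ring G)"
  by (simp add: burnside_class_closed gset_sym_power_iso)

text \<open>Adding the class of \<open>T\<close> to the difference gives the class of
  \<open>S\<close>, so multiplicativity forces the value on the difference to be a quotient of two
  known series. This yields uniqueness and dictates the construction.\<close>

lemma sigma_property_diff:
  fixes S T :: "('a, nat) gset"
  assumes s: "sigma_property s" and S: "finite_gset G S" and T: "finite_gset G T" and H: "H \<subseteq> carrier G"
  shows "mark_series (s (burnside_diff G S T)) H * Abs_fps (\<lambda>n. mark (mset_gset n T) H) =
    Abs_fps (\<lambda>n. mark (mset_gset n S) H)"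
proof -
  let ?x = "burnside_diff G S T"
  have x: "?x \<in> carrier (burnside_ring G)" using S T by (rule burnside_diff_closed)
  have cl: "burnside_class G T \<in> carrier (burnside_ring G)" using T by (rule burnside_class_closed)
  have "?x \<oplus>\<^bsub>burnside_ring G\<^esub> burnside_class G T = burnside_class G S"
    by (rule burnside_ring_eqI[of _ G])
      (use S T x cl in \<open>simp_all add: burnside_add_closed burnside_class_closed burnside_mark_add
        burnside_mark_diff burnside_mark_class\<close>)
  then have "s (burnside_class G S) = series_mult (burnside_ring G) (s ?x) (s (burnside_class G T))"
    using s x cl unfolding sigma_property_def by metis
  moreover have "s (burnside_class G S) = (\<lambda>n. burnside_class G (gset_sym_power n S))"
    "s (burnside_class G T) = (\<lambda>n. burnside_class G (gset_sym_power n T))"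
    using sigma_property_class[OF s S] sigma_property_class[OF s T] by simp_all
  moreover have "s ?x \<in> UNIV \<rightarrow> carrier (burnside_ring G)"
    using s x unfolding sigma_property_def by (auto simp: PiE_def Pi_def)
  ultimately show ?thesis
    using mark_series_mult[of "s ?x" "\<lambda>n. burnside_class G (gset_sym_power n T)" H]
      sym_power_closed[OF T] H mark_series_sym_power[OF S H] mark_series_sym_power[OF T H] by simp
qed

lemma sigma_property_unique:
  assumes s: "sigma_property s" and s': "sigma_property s'"
  shows "s = s'"
proof
  fix x
  show "s x = s' x"
  proof (cases "x \<in> carrier (burnside_ring G)")
    case True
    then obtain S T :: "('a, nat) gset" where ST: "finite_gset G S" "finite_gset G T"
      "x = burnside_diff G S T" by (rule burnside_ringE)
    show ?thesis
    proof (rule series_eqI)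
      show "s x \<in> UNIV \<rightarrow> carrier (burnside_ring G)" "s' x \<in> UNIV \<rightarrow> carrier (burnside_ring G)"
        using s s' True unfolding sigma_property_def by (auto simp: PiE_def Pi_def)
      show "mark_series (s x) H = mark_series (s' x) H" if "H \<subseteq> carrier G" for H
        using sigma_property_diff[OF s ST(1,2) that] sigma_property_diff[OF s' ST(1,2) that]
          mset_gset_series_nonzero ST(3) by (metis mult_right_cancel)
    qed
  next
    case False
    then show ?thesis
      using PiE_arb[OF s[unfolded sigma_property_def, THEN conjunct1] False]
        PiE_arb[OF s'[unfolded sigma_property_def, THEN conjunct1] False] by simp
  qed
qed

lemma sigma_property_exists: "\<exists>s. sigma_property s"
proof -
  define C where "C S n = burnside_class G (gset_sym_power n S)" for S :: "('a, nat) gset" and n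
  \<comment> \<open>One representing pair is chosen for each element, and the value is the quotient
    of its two series of symmetric powers.\<close>
  define rep :: "'a burnside \<Rightarrow> ('a, nat) gset \<times> ('a, nat) gset"
    where "rep x = (SOME p. finite_gset G (fst p) \<and> finite_gset G (snd p) \<and>
      x = burnside_diff G (fst p) (snd p))" for x
  define s where "s = (\<lambda>x\<in>carrier (burnside_ring G).
    series_div (burnside_ring G) (C (fst (rep x))) (C (snd (rep x))))"
  have C: "C S \<in> UNIV \<rightarrow> carrier (burnside_ring G)" "C S 0 = \<one>\<^bsub>burnside_ring G\<^esub>"
    "\<And>H. H \<subseteq> carrier G \<Longrightarrow> mark_series (C S) H = Abs_fps (\<lambda>n. mark (mset_gset n S) H)"
    if "finite_gset G S" for S
    unfolding C_def
    using sym_power_closed[OF that] sym_power_0[OF that] mark_series_sym_power[OF that] by simp_all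
  have rep: "finite_gset G (fst (rep x)) \<and> finite_gset G (snd (rep x)) \<and>
      x = burnside_diff G (fst (rep x)) (snd (rep x))" if x: "x \<in> carrier (burnside_ring G)" for x
  proof -
    obtain S T :: "('a, nat) gset" where "finite_gset G S" "finite_gset G T" "x = burnside_diff G S T"
      using x by (rule burnside_ringE)
    then have "finite_gset G (fst (S, T)) \<and> finite_gset G (snd (S, T)) \<and>
        x = burnside_diff G (fst (S, T)) (snd (S, T))" by simp
    then show ?thesis unfolding rep_def by (rule someI)
  qed
  have s_closed: "s x \<in> UNIV \<rightarrow> carrier (burnside_ring G)" if "x \<in> carrier (burnside_ring G)" for x
    using that rep[OF that] C(1) series_div_closed by (simp add: s_def)
  \<comment> \<open>The quotient equation holds for every representing pair, not only for the chosen
    one; the series of \<open>T0\<close> is cancelled at the end.\<close>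
  have key: "mark_series (s (burnside_diff G S T)) H * Abs_fps (\<lambda>n. mark (mset_gset n T) H) =
      Abs_fps (\<lambda>n. mark (mset_gset n S) H)"
    if S: "finite_gset G S" and T: "finite_gset G T" and H: "H \<subseteq> carrier G"
    for S T :: "('a, nat) gset" and H
  proof -
    let ?x = "burnside_diff G S T"
    define S0 T0 where "S0 = fst (rep ?x)" and "T0 = snd (rep ?x)"
    have x: "?x \<in> carrier (burnside_ring G)" using S T by (rule burnside_diff_closed)
    have ST0: "finite_gset G S0" "finite_gset G T0" "?x = burnside_diff G S0 T0"
      using rep[OF x] by (simp_all add: S0_def T0_def)
    let ?F = "\<lambda>S :: ('a, nat) gset. Abs_fps (\<lambda>n. mark (mset_gset n S) H)"
    have 1: "mark_series (s ?x) H * ?F T0 = ?F S0"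
      using mark_series_div[OF C(1)[OF ST0(2)] C(1)[OF ST0(1)] H C(2)[OF ST0(2)]] x
        C(3)[OF ST0(1) H] C(3)[OF ST0(2) H] by (simp add: s_def S0_def T0_def)
    have 2: "?F S * ?F T0 = ?F S0 * ?F T"
      by (rule mset_gset_series_diff_eq[OF S T ST0(1,2,3) H])
    have "(mark_series (s ?x) H * ?F T) * ?F T0 = (mark_series (s ?x) H * ?F T0) * ?F T"
      by (simp only: mult_ac)
    also have "\<dots> = ?F S * ?F T0" unfolding 1 2 ..
    finally show ?thesis
      using mset_gset_series_nonzero by (metis mult_right_cancel)
  qed
  have "sigma_property s"
    unfolding sigma_property_def
  proof (intro conjI allI impI ballI)
    show "s \<in> carrier (burnside_ring G) \<rightarrow>\<^sub>E (UNIV \<rightarrow> carrier (burnside_ring G))"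
      using s_closed by (auto simp: s_def PiE_def)
  next
    fix S :: "('a, nat) gset" and n assume S: "finite_gset G S"
    let ?E = "gset_empty :: ('a, nat) gset"
    have E: "finite_gset G ?E" by (rule finite_gset_empty[OF is_group])
    \<comment> \<open>The class of \<open>S\<close> is its difference with the empty set, whose
      series is 1, so the division changes nothing.\<close>
    have "Abs_fps (\<lambda>n. mark (mset_gset n ?E) H) = 1" for H
    proof (rule fps_ext)
      fix n show "fps_nth (Abs_fps (\<lambda>n. mark (mset_gset n ?E) H)) n = fps_nth 1 n"
        by (cases n) (simp_all add: mark_mset_gset_0 mark_mset_gset_empty)
    qed
    then have "mark_series (s (burnside_class G S)) H = mark_series (C S) H" if "H \<subseteq> carrier G" for H
      using key[OF S E that] C(3)[OF S that] by (simp add: burnside_class_def)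
    then have "s (burnside_class G S) = C S"
      using s_closed[OF burnside_class_closed[OF S]] C(1)[OF S] by (intro series_eqI) auto
    then show "s (burnside_class G S) n = burnside_class G (gset_sym_power n S)"
      by (simp add: C_def)
  next
    fix x y assume x: "x \<in> carrier (burnside_ring G)" and y: "y \<in> carrier (burnside_ring G)"
    obtain S T :: "('a, nat) gset" where ST: "finite_gset G S" "finite_gset G T" "x = burnside_diff G S T"
      using x by (rule burnside_ringE)
    obtain S' T' :: "('a, nat) gset"
      where ST': "finite_gset G S'" "finite_gset G T'" "y = burnside_diff G S' T'"
      using y by (rule burnside_ringE)
    have xy: "x \<oplus>\<^bsub>burnside_ring G\<^esub> y \<in> carrier (burnside_ring G)"
      using x y by (rule burnside_add_closed)
    then obtain S'' T'' :: "('a, nat) gset" where ST'': "finite_gset G S''" "finite_gset G T''"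
        "x \<oplus>\<^bsub>burnside_ring G\<^esub> y = burnside_diff G S'' T''"
      by (rule burnside_ringE)
    show "s (x \<oplus>\<^bsub>burnside_ring G\<^esub> y) = series_mult (burnside_ring G) (s x) (s y)"
    proof (rule series_eqI)
      fix H assume H: "H \<subseteq> carrier G"
      let ?F = "\<lambda>S. Abs_fps (\<lambda>n. mark (mset_gset n S) H)"
      let ?m = "\<lambda>x. mark_series (s x) H"
      have sums: "finite_gset G (gset_sum S S')" "finite_gset G (gset_sum T T')"
        using ST ST' by (simp_all add: finite_gset_sum)
      have "burnside_diff G S'' T'' = burnside_diff G (gset_sum S S') (gset_sum T T')"
        using ST ST' ST''(3) by (simp add: burnside_add_diff)
      from mset_gset_series_diff_eq[OF ST''(1,2) sums this H]
      have "?F S'' * (?F T * ?F T') = ?F S * ?F S' * ?F T''"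
        using mset_gset_series_sum[OF ST(1) ST'(1) H] mset_gset_series_sum[OF ST(2) ST'(2) H] by simp
      \<comment> \<open>Each numerator is replaced by value times denominator through
        \<open>key\<close>; the three denominators can then be cancelled together.\<close>
      then have "(?m (x \<oplus>\<^bsub>burnside_ring G\<^esub> y) * ?F T'') * (?F T * ?F T') =
          (?m x * ?F T) * (?m y * ?F T') * ?F T''"
        using key[OF ST(1,2) H] key[OF ST'(1,2) H] key[OF ST''(1,2) H] ST(3) ST'(3) ST''(3) by simp
      then have "?m (x \<oplus>\<^bsub>burnside_ring G\<^esub> y) * (?F T'' * ?F T * ?F T') =
          (?m x * ?m y) * (?F T'' * ?F T * ?F T')"
        by (simp only: mult_ac)
      moreover have "?F T'' * ?F T * ?F T' \<noteq> 0"
        using mset_gset_series_nonzero by (metis mult_eq_0_iff)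
      ultimately have "?m (x \<oplus>\<^bsub>burnside_ring G\<^esub> y) = ?m x * ?m y"
        by (metis mult_right_cancel)
      then show "mark_series (s (x \<oplus>\<^bsub>burnside_ring G\<^esub> y)) H =
          mark_series (series_mult (burnside_ring G) (s x) (s y)) H"
        using mark_series_mult[OF s_closed[OF x] s_closed[OF y] H] by simp
    qed (use s_closed x y xy series_mult_closed in auto)
  qed
  then show ?thesis by blast
qed

lemma burnside_sigma_series_class:
  fixes S :: "('a, nat) gset"
  assumes "finite_gset G S"
  shows "burnside_sigma_series G (burnside_class G S) = (\<lambda>n. burnside_class G (gset_sym_power n S))"
proof -
  have "sigma_property (THE s. sigma_property s)"
    using sigma_property_exists sigma_property_unique by (metis theI)
  then have "sigma_property (burnside_sigma_series G)"
    unfolding burnside_sigma_series_def sigma_property_def .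
  then show ?thesis
    using assms by (rule sigma_property_class)
qed

text \<open>The defining equation has at most one solution because the sigma series is nonzero at
  each \<open>H\<close>. A candidate needs only to be an inverse in integer series; the signs come
  from the argument \<open>-t\<close>.\<close>

lemma burnside_lambda_series_class:
  fixes S :: "('a, nat) gset"
  assumes S: "finite_gset G S" and l: "l \<in> UNIV \<rightarrow> carrier (burnside_ring G)"
    and inverse: "\<And>H. H \<subseteq> carrier G \<Longrightarrow> Abs_fps (\<lambda>n. mark (mset_gset n S) H) *
      Abs_fps (\<lambda>n. (- 1) ^ n * burnside_mark (l n) H) = 1"
  shows "burnside_lambda_series G (burnside_class G S) = l"
proof -
  let ?R = "burnside_ring G"
  let ?C = "\<lambda>n. burnside_class G (gset_sym_power n S)"
  have neg: "mark_series (series_neg_arg ?R k) H = Abs_fps (\<lambda>n. (- 1) ^ n * burnside_mark (k n) H)"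
    if "k \<in> UNIV \<rightarrow> carrier ?R" "H \<subseteq> carrier G" for k H
    by (rule fps_ext) (use that in \<open>auto simp: series_neg_arg_def burnside_mark_add_pow Pi_iff\<close>)
  have mult: "mark_series (series_mult ?R ?C (series_neg_arg ?R k)) H =
      Abs_fps (\<lambda>n. mark (mset_gset n S) H) * Abs_fps (\<lambda>n. (- 1) ^ n * burnside_mark (k n) H)"
    if "k \<in> UNIV \<rightarrow> carrier ?R" "H \<subseteq> carrier G" for k H
    using mark_series_mult[OF sym_power_closed[OF S] series_neg_arg_closed[OF that(1)] that(2)]
      neg[OF that] mark_series_sym_power[OF S that(2)] by simp
  show ?thesis
    unfolding burnside_lambda_series_def burnside_sigma_series_class[OF S]
  proof (rule the_equality, intro conjI)
    show "series_mult ?R ?C (series_neg_arg ?R l) = series_one ?R"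
      by (rule series_eqI)
        (use sym_power_closed[OF S] series_neg_arg_closed[OF l] l in
          \<open>simp_all add: series_mult_closed series_one_closed mult inverse mark_series_one\<close>)
  next
    fix k assume k: "k \<in> UNIV \<rightarrow> carrier ?R \<and> series_mult ?R ?C (series_neg_arg ?R k) = series_one ?R"
    show "k = l"
    proof (rule series_eqI)
      fix H assume H: "H \<subseteq> carrier G"
      have "Abs_fps (\<lambda>n. mark (mset_gset n S) H) * Abs_fps (\<lambda>n. (- 1) ^ n * burnside_mark (k n) H) =
          Abs_fps (\<lambda>n. mark (mset_gset n S) H) * Abs_fps (\<lambda>n. (- 1) ^ n * burnside_mark (l n) H)"
        using mult[of k H] k H inverse[OF H] mark_series_one[OF H] by simp
      then have "Abs_fps (\<lambda>n. (- 1) ^ n * burnside_mark (k n) H) =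
          Abs_fps (\<lambda>n. (- 1) ^ n * burnside_mark (l n) H)"
        by (simp only: mult_left_cancel[OF mset_gset_series_nonzero])
      from arg_cong[OF this, of "\<lambda>F. fps_nth F n" for n]
      have "burnside_mark (k n) H = burnside_mark (l n) H" for n
        by simp
      then show "mark_series k H = mark_series l H"
        by (intro fps_ext) simp
    qed (use k l in auto)
  qed (rule l)
qed

end

section \<open>Fixed multisets and tuples of stable subsets\<close>

text \<open>The sizes may come in any order, so these tuples belong to compositions of
  \<open>i\<close>. As \<open>disjnt\<close> is symmetric, \<open>sorted_wrt\<close> expresses
  pairwise disjointness.\<close>

definition stable_tuples :: "'a set \<Rightarrow> ('a \<Rightarrow> 'a) set \<Rightarrow> nat \<Rightarrow> 'a set list set"
  where "stable_tuples X H i = {Ts. (\<forall>T\<in>set Ts. T \<subseteq> X \<and> T \<noteq> {} \<and> (\<forall>h\<in>H. h ` T = T)) \<and>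
    sorted_wrt disjnt Ts \<and> sum_list (map card Ts) = i}"

definition stable_msets :: "'a set \<Rightarrow> ('a \<Rightarrow> 'a) set \<Rightarrow> nat \<Rightarrow> 'a multiset set"
  where "stable_msets X H k = {M \<in> multisets_of_size X k. \<forall>h\<in>H. image_mset h M = M}"

lemma length_le_sum_list:
  "(\<And>m. m \<in> set ms \<Longrightarrow> 0 < m) \<Longrightarrow> length ms \<le> sum_list (ms :: nat list)"
proof (induction ms)
  case (Cons m ms)
  then have "0 < m" "length ms \<le> sum_list ms" by simp_all
  then show ?case by simp
qed simp

lemma finite_stable_tuples:
  assumes "finite X"
  shows "finite (stable_tuples X H i)"
proof (rule finite_subset)
  show "stable_tuples X H i \<subseteq> {Ts. set Ts \<subseteq> Pow X \<and> length Ts \<le> i}"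
  proof clarify
    fix Ts assume Ts: "Ts \<in> stable_tuples X H i"
    then have pos: "0 < m" if "m \<in> set (map card Ts)" for m
      using that assms finite_subset by (fastforce simp: stable_tuples_def card_gt_0_iff)
    have "length (map card Ts) \<le> sum_list (map card Ts)"
      by (rule length_le_sum_list) (rule pos)
    with Ts show "set Ts \<subseteq> Pow X \<and> length Ts \<le> i" by (auto simp: stable_tuples_def)
  qed
  show "finite {Ts. set Ts \<subseteq> Pow X \<and> length Ts \<le> i}"
    using assms by (intro finite_lists_length_le) simp
qed

lemma finite_stable_msets: "finite X \<Longrightarrow> finite (stable_msets X H k)"
  by (simp add: stable_msets_def finite_multisets_of_size)

text \<open>The sign-reversing involution. If a tuple covers the support of \<open>M\<close> and the total size is positive,
  then the tuple is nonempty, so its \<open>hd\<close> is meaningful.\<close>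

definition toggle :: "'a multiset \<times> 'a set list \<Rightarrow> 'a multiset \<times> 'a set list"
  where "toggle = (\<lambda>(M, Ts). let T = set_mset M - \<Union> (set Ts) in
    if T = {} then (M + mset_set (hd Ts), tl Ts) else (M - mset_set T, T # Ts))"

text \<open>With the sign of the tuple, these pairs are counted by the coefficient at
  \<open>i\<close> of the product of the two generating functions.\<close>

definition stable_pairs :: "'a set \<Rightarrow> ('a \<Rightarrow> 'a) set \<Rightarrow> nat \<Rightarrow> ('a multiset \<times> 'a set list) set"
  where "stable_pairs X H i = (\<Union>k\<le>i. stable_msets X H k \<times> stable_tuples X H (i - k))"

lemma stable_pairs_iff:
  "(M, Ts) \<in> stable_pairs X H i \<longleftrightarrow> set_mset M \<subseteq> X \<and> (\<forall>h\<in>H. image_mset h M = M) \<and>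
    (\<forall>T\<in>set Ts. T \<subseteq> X \<and> T \<noteq> {} \<and> (\<forall>h\<in>H. h ` T = T)) \<and> sorted_wrt disjnt Ts \<and>
    size M + sum_list (map card Ts) = i"
  by (auto simp: stable_pairs_def stable_msets_def stable_tuples_def mem_multisets_of_size)

text \<open>Let \<open>R\<close> be the part of the support of \<open>M\<close> that the tuple
  misses. If \<open>R\<close> is nonempty, moving one copy of each of its points to the front of the
  tuple leaves nothing missed. If \<open>R\<close> is empty, moving the head into \<open>M\<close>
  makes exactly that head missed, since the other subsets are disjoint from it and cover the rest.
  So the two cases undo each other, and the length changes by one.\<close>

lemma toggle_stable_pairs:
  assumes X: "finite X" and inj: "\<And>h. h \<in> H \<Longrightarrow> inj_on h X" and i: "0 < i"
    and p: "(M, Ts) \<in> stable_pairs X H i"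
  shows "toggle (M, Ts) \<in> stable_pairs X H i \<and> toggle (toggle (M, Ts)) = (M, Ts) \<and>
    (- 1 :: int) ^ length (snd (toggle (M, Ts))) = - ((- 1) ^ length Ts)"
proof -
  from p have M: "set_mset M \<subseteq> X" "\<And>h. h \<in> H \<Longrightarrow> image_mset h M = M"
    and Ts: "\<And>T. T \<in> set Ts \<Longrightarrow> T \<subseteq> X \<and> T \<noteq> {} \<and> (\<forall>h\<in>H. h ` T = T)" "sorted_wrt disjnt Ts"
    and size: "size M + sum_list (map card Ts) = i"
    by (auto simp: stable_pairs_iff)
  have ims: "image_mset h (mset_set T) = mset_set T" if "T \<subseteq> X" "h \<in> H" "h ` T = T" for h T
    using image_mset_mset_set[OF inj_on_subset[OF inj[OF that(2)] that(1)]] that(3) by simp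
  define R where "R = set_mset M - \<Union> (set Ts)"
  show ?thesis
  proof (cases "R = {}")
    case True
    have "Ts \<noteq> []"
    proof
      assume "Ts = []"
      with True have "M = {#}" by (simp add: R_def)
      with \<open>Ts = []\<close> size i show False by simp
    qed
    then obtain T Us where TU: "Ts = T # Us" by (cases Ts) auto
    have finT: "finite T" using Ts(1)[of T] X finite_subset by (auto simp: TU)
    have tog: "toggle (M, Ts) = (M + mset_set T, Us)"
      using True by (simp add: toggle_def R_def TU)
    have eqT: "set_mset (M + mset_set T) - \<Union> (set Us) = T"
      using True Ts(2) finT by (auto simp: R_def TU disjnt_def)
    have "T \<noteq> {}" using Ts(1)[of T] by (simp add: TU)
    then have "toggle (M + mset_set T, Us) = (M, Ts)"
      unfolding toggle_def prod.case eqT by (simp add: TU)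
    moreover have "(M + mset_set T, Us) \<in> stable_pairs X H i"
      unfolding stable_pairs_iff using M Ts size ims finT by (auto simp: TU)
    ultimately show ?thesis by (simp add: tog) (simp add: TU)
  next
    case False
    have sub: "mset_set R \<subseteq># M"
      by (rule subset_mset.order_trans[OF subset_imp_msubset_mset_set mset_set_set_mset_msubset])
        (auto simp: R_def)
    have finR: "finite R" by (simp add: R_def)
    have RX: "R \<subseteq> X" using M(1) by (auto simp: R_def)
    have tog: "toggle (M, Ts) = (M - mset_set R, R # Ts)"
      using False by (simp add: toggle_def R_def Let_def)
    \<comment> \<open>Support and union are stable; injectivity of \<open>h\<close> on
      \<open>X\<close> lets its image commute with their difference.\<close>
    have hR: "h ` R = R" if h: "h \<in> H" for h
    proof -
      have UX: "\<Union> (set Ts) \<subseteq> X" using Ts(1) by auto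
      have "h ` R = h ` set_mset M - h ` \<Union> (set Ts)"
        unfolding R_def by (rule inj_on_image_set_diff[OF inj[OF h]]) (use M(1) UX in auto)
      moreover have "h ` set_mset M = set_mset M"
        using arg_cong[OF M(2)[OF h], of set_mset] by simp
      moreover have "h ` \<Union> (set Ts) = \<Union> (set Ts)"
        using Ts(1) h by (auto simp: image_Union)
      ultimately show ?thesis by (simp add: R_def)
    qed
    have "size (M - mset_set R) + card R = size M"
      using size_mset_mono[OF sub] by (simp add: size_Diff_submset[OF sub])
    moreover have "image_mset h (M - mset_set R) = M - mset_set R" if "h \<in> H" for h
      using image_mset_Diff[OF sub, of h] M(2)[OF that] ims[OF RX that hR[OF that]] by simp
    moreover have "set_mset (M - mset_set R) \<subseteq> set_mset M" by (meson in_diffD subsetI)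
    moreover have "sorted_wrt disjnt (R # Ts)"
      using Ts(2) by (auto simp: R_def disjnt_def)
    ultimately have "(M - mset_set R, R # Ts) \<in> stable_pairs X H i"
      unfolding stable_pairs_iff using M Ts size RX hR False by auto
    moreover have eqR: "set_mset (M - mset_set R) - \<Union> (set (R # Ts)) = {}"
      using \<open>set_mset (M - mset_set R) \<subseteq> set_mset M\<close> by (auto simp: R_def)
    have "toggle (M - mset_set R, R # Ts) = (M, Ts)"
      unfolding toggle_def prod.case eqR using sub by (simp add: subset_mset.diff_add)
    ultimately show ?thesis by (simp add: tog)
  qed
qed

lemma sum_stable_pairs:
  assumes X: "finite X" and inj: "\<And>h. h \<in> H \<Longrightarrow> inj_on h X" and i: "0 < i"
  shows "(\<Sum>k\<le>i. int (card (stable_msets X H k)) *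
    (\<Sum>Ts\<in>stable_tuples X H (i - k). (- 1) ^ length Ts)) = 0"
proof -
  let ?s = "\<lambda>p. (- 1 :: int) ^ length (snd p)"
  have tog: "toggle p \<in> stable_pairs X H i \<and> toggle (toggle p) = p \<and> ?s (toggle p) = - ?s p"
    if "p \<in> stable_pairs X H i" for p
    using toggle_stable_pairs[where M = "fst p" and Ts = "snd p", OF X inj i] that by simp
  have "(\<Sum>p\<in>stable_pairs X H i. ?s p) = (\<Sum>p\<in>stable_pairs X H i. - ?s p)"
    by (rule sum.reindex_bij_witness[where i = toggle and j = toggle]) (use tog in auto)
  then have zero: "(\<Sum>p\<in>stable_pairs X H i. ?s p) = 0" by (simp add: sum_negf)
  have "(\<Sum>p\<in>stable_pairs X H i. ?s p) =
      (\<Sum>k\<le>i. \<Sum>p\<in>stable_msets X H k \<times> stable_tuples X H (i - k). ?s p)"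
    unfolding stable_pairs_def
  proof (rule sum.UNION_disjoint)
    show "\<forall>k\<in>{..i}. finite (stable_msets X H k \<times> stable_tuples X H (i - k))"
      by (simp add: finite_stable_msets finite_stable_tuples X)
  qed (auto simp: stable_msets_def mem_multisets_of_size)
  also have "\<dots> = (\<Sum>k\<le>i. int (card (stable_msets X H k)) *
      (\<Sum>Ts\<in>stable_tuples X H (i - k). (- 1) ^ length Ts))"
    by (simp add: sum.cartesian_product')
  finally show ?thesis using zero by simp
qed

section \<open>From tuples with sizes in any order to partitions\<close>

lemma sorted_wrt_disjnt_iff:
  "sorted_wrt disjnt Ts \<longleftrightarrow>
    (\<forall>j<length Ts. \<forall>k<length Ts. j \<noteq> k \<longrightarrow> Ts ! j \<inter> Ts ! k = {})" (is "?L \<longleftrightarrow> ?R")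
proof
  assume L: ?L
  show ?R
  proof (intro allI impI)
    fix j k assume "j < length Ts" "k < length Ts" "j \<noteq> k"
    moreover from this consider "j < k" | "k < j" by linarith
    ultimately show "Ts ! j \<inter> Ts ! k = {}"
      using L unfolding sorted_wrt_iff_nth_less disjnt_def by cases blast+
  qed
qed (auto simp: sorted_wrt_iff_nth_less disjnt_def)

text \<open>Permuting the entries preserves disjointness and stability. The hypothesis is symmetric
  in \<open>a\<close> and \<open>b\<close>, so two uses give equality.\<close>

lemma card_stable_tuples_permute:
  assumes X: "finite X" and ab: "mset a = mset b"
  shows "card {Ts \<in> stable_tuples X H i. map card Ts = a} \<le> card {Ts \<in> stable_tuples X H i. map card Ts = b}"
proof -
  obtain p where p: "p permutes {..<length a}" "permute_list p a = b"
    using mset_eq_permutation[OF ab[symmetric]] by metis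
  let ?A = "{Ts \<in> stable_tuples X H i. map card Ts = a}"
  have len: "length Ts = length a" if "Ts \<in> ?A" for Ts
    using that by (metis (mono_tags) length_map mem_Collect_eq)
  have "inj_on (permute_list p) ?A"
  proof (rule inj_onI)
    fix xs ys assume xs: "xs \<in> ?A" and ys: "ys \<in> ?A" and eq: "permute_list p xs = permute_list p ys"
    \<comment> \<open>Entry \<open>j\<close> of the permuted list is entry \<open>p j\<close> of the
      original, and every position has the form \<open>p j\<close>.\<close>
    have "xs ! (p j) = ys ! (p j)" if "j < length a" for j
      using arg_cong[OF eq, of "\<lambda>zs. zs ! j"] p(1) len[OF xs] len[OF ys] that
      by (simp add: permute_list_nth)
    then have "xs ! j = ys ! j" if "j < length a" for j
      using permutes_surj[OF p(1)] that permutes_in_image[OF p(1)] by (metis lessThan_iff surjD)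
    then show "xs = ys" using len[OF xs] len[OF ys] by (simp add: nth_equalityI)
  qed
  moreover have "permute_list p Ts \<in> {Ts \<in> stable_tuples X H i. map card Ts = b}" if Ts: "Ts \<in> ?A" for Ts
  proof -
    have pl: "p permutes {..<length Ts}" using p(1) len[OF Ts] by simp
    have "sorted_wrt disjnt Ts" using Ts by (simp add: stable_tuples_def)
    then have "sorted_wrt disjnt (permute_list p Ts)"
      unfolding sorted_wrt_disjnt_iff
      using permutes_in_image[OF pl] inj_eq[OF permutes_inj[OF pl]] by (simp add: permute_list_nth[OF pl])
    moreover have "map card (permute_list p Ts) = b"
      using Ts p permute_list_map[OF pl, of card] by auto
    moreover have "sum_list b = sum_list a" using ab by (metis sum_mset_sum_list)
    ultimately show ?thesis using Ts pl by (auto simp: stable_tuples_def)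
  qed
  ultimately show ?thesis
    using finite_stable_tuples[OF X] by (intro card_inj_on_le[where f = "permute_list p"]) auto
qed

text \<open>The combinatorial meaning of the coefficient: the distinct rearrangements of
  \<open>\<mu>\<close> are the permutations of a multiset with the multiplicities
  \<open>part_mults \<mu>\<close>.\<close>

lemma card_permutations_multinomial:
  "card (permutations_of_multiset (mset \<mu>)) = multinomial (length \<mu>) (part_mults \<mu>)"
proof -
  have "(\<Prod>x\<in>set \<mu>. fact (count_list \<mu> x)) = prod_list (map (\<lambda>x. fact (count_list \<mu> x) :: nat) (remdups \<mu>))"
    using prod.distinct_set_conv_list[of "remdups \<mu>"] by simp
  then show ?thesis
    by (simp add: card_permutations_of_multiset multinomial_def part_mults_def comp_def count_mset)
qed

text \<open>Split by the actual sequence of sizes: each rearrangement of \<open>\<mu>\<close>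
  contributes the same number of tuples.\<close>

lemma card_stable_tuples_mset:
  assumes X: "finite X"
  shows "card {Ts \<in> stable_tuples X H i. mset (map card Ts) = mset \<mu>} =
    multinomial (length \<mu>) (part_mults \<mu>) * card {Ts \<in> stable_tuples X H i. map card Ts = \<mu>}"
proof -
  let ?S = "{Ts \<in> stable_tuples X H i. mset (map card Ts) = mset \<mu>}"
  have fin: "finite ?S" using finite_stable_tuples[OF X] by simp
  have "card ?S = (\<Sum>a\<in>permutations_of_multiset (mset \<mu>). card {Ts \<in> ?S. map card Ts = a})"
    using sum.group[OF fin finite_permutations_of_multiset, of "map card" "mset \<mu>" "\<lambda>_. 1 :: nat"]
    by (simp add: permutations_of_multiset_def image_subset_iff)
  also have "\<dots> = (\<Sum>a\<in>permutations_of_multiset (mset \<mu>). card {Ts \<in> stable_tuples X H i. map card Ts = \<mu>})"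
  proof (rule sum.cong)
    fix a assume "a \<in> permutations_of_multiset (mset \<mu>)"
    then have a: "mset a = mset \<mu>" by (simp add: permutations_of_multiset_def)
    then have "{Ts \<in> ?S. map card Ts = a} = {Ts \<in> stable_tuples X H i. map card Ts = a}" by auto
    then show "card {Ts \<in> ?S. map card Ts = a} = card {Ts \<in> stable_tuples X H i. map card Ts = \<mu>}"
      using card_stable_tuples_permute[OF X a] card_stable_tuples_permute[OF X a[symmetric]]
      by (simp add: order_antisym)
  qed simp
  finally show ?thesis by (simp add: card_permutations_multinomial)
qed

lemma finite_partitions_of: "finite (partitions_of i)"
proof (rule finite_subset)
  show "partitions_of i \<subseteq> {\<mu>. set \<mu> \<subseteq> {..i} \<and> length \<mu> \<le> i}"
    using length_le_sum_list member_le_sum_list by (auto simp: partitions_of_def)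
qed (simp add: finite_lists_length_le)

lemma sum_stable_tuples:
  assumes X: "finite X"
  shows "(\<Sum>Ts\<in>stable_tuples X H i. (- 1 :: int) ^ length Ts) =
    (\<Sum>\<mu>\<in>partitions_of i. (- 1) ^ length \<mu> * int (multinomial (length \<mu>) (part_mults \<mu>)) *
      int (card {Ts \<in> stable_tuples X H i. map card Ts = \<mu>}))"
proof -
  \<comment> \<open>Tuples are grouped by their sizes in decreasing order, the normal form used in
    \<open>partitions_of\<close>.\<close>
  let ?g = "\<lambda>Ts. rev (sort (map card Ts))"
  have g_iff: "?g Ts = \<mu> \<longleftrightarrow> mset (map card Ts) = mset \<mu>" if "\<mu> \<in> partitions_of i" for Ts :: "'a set list" and \<mu>
  proof
    assume "mset (map card Ts) = mset \<mu>"
    moreover have "sorted (rev \<mu>)" using that by (simp add: partitions_of_def sorted_wrt_rev)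
    ultimately have "sort (map card Ts) = rev \<mu>" by (intro properties_for_sort) simp_all
    then show "?g Ts = \<mu>" by simp
  qed auto
  have "?g Ts \<in> partitions_of i" if Ts: "Ts \<in> stable_tuples X H i" for Ts
  proof -
    have "sum_list (rev (sort (map card Ts))) = sum_list (map card Ts)"
      by (metis mset_rev mset_sort sum_mset_sum_list)
    moreover have "0 < card T" if "T \<in> set Ts" for T
      using that Ts X finite_subset by (fastforce simp: stable_tuples_def card_gt_0_iff)
    ultimately show ?thesis
      using Ts by (auto simp: partitions_of_def stable_tuples_def sorted_wrt_rev)
  qed
  then have "(\<Sum>Ts\<in>stable_tuples X H i. (- 1 :: int) ^ length Ts) =
      (\<Sum>\<mu>\<in>partitions_of i. \<Sum>Ts\<in>{Ts \<in> stable_tuples X H i. ?g Ts = \<mu>}. (- 1) ^ length Ts)"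
    by (intro sum.group[symmetric] finite_stable_tuples[OF X] finite_partitions_of) auto
  also have "\<dots> = (\<Sum>\<mu>\<in>partitions_of i. (- 1) ^ length \<mu> *
      int (card {Ts \<in> stable_tuples X H i. mset (map card Ts) = mset \<mu>}))"
  proof (rule sum.cong)
    fix \<mu> assume \<mu>: "\<mu> \<in> partitions_of i"
    let ?S = "{Ts \<in> stable_tuples X H i. mset (map card Ts) = mset \<mu>}"
    have "(\<Sum>Ts\<in>?S. (- 1 :: int) ^ length Ts) = (\<Sum>Ts\<in>?S. (- 1) ^ length \<mu>)"
    proof (rule sum.cong)
      fix Ts assume "Ts \<in> ?S"
      then have "length Ts = length \<mu>" by (metis (mono_tags) length_map mem_Collect_eq mset_eq_length)
      then show "(- 1 :: int) ^ length Ts = (- 1) ^ length \<mu>" by simp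
    qed simp
    then show "(\<Sum>Ts\<in>{Ts \<in> stable_tuples X H i. ?g Ts = \<mu>}. (- 1 :: int) ^ length Ts) =
        (- 1) ^ length \<mu> * int (card ?S)"
      using g_iff[OF \<mu>] by simp
  qed simp
  finally show ?thesis
    by (simp only: card_stable_tuples_mset[OF X] of_nat_mult mult.assoc)
qed

section \<open>The natural set and the tuple sets of the symmetric group, with their marks\<close>

lemma finite_natural_gset: "finite_gset (sym_group n) (natural_gset n)"
proof (rule finite_gsetI[OF sym_group_is_group])
  show "snd (natural_gset n) g \<in> fst (natural_gset n) \<rightarrow>\<^sub>E fst (natural_gset n)"
    if "g \<in> carrier (sym_group n)" for g
    using that permutes_in_image[of g "{1..n}"] by (auto simp: natural_gset_def sym_group_carrier)
  show "snd (natural_gset n) (g \<otimes>\<^bsub>sym_group n\<^esub> h) x = snd (natural_gset n) g (snd (natural_gset n) h x)"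
    if "h \<in> carrier (sym_group n)" "x \<in> fst (natural_gset n)" for g h x
    using that permutes_in_image[of h "{1..n}" x]
    by (auto simp: natural_gset_def sym_group_carrier sym_group_mult)
qed (simp_all add: natural_gset_def sym_group_one)

lemma mem_partition_gset:
  "Ts \<in> fst (partition_gset n \<mu>) \<longleftrightarrow>
    map card Ts = \<mu> \<and> (\<forall>T\<in>set Ts. T \<subseteq> {1..n}) \<and> sorted_wrt disjnt Ts"
proof -
  have iff: "map card Ts = \<mu> \<longleftrightarrow> length Ts = length \<mu> \<and> (\<forall>j<length \<mu>. card (Ts ! j) = \<mu> ! j)"
    by (auto simp: list_eq_iff_nth_eq)
  show ?thesis
  proof (cases "length Ts = length \<mu>")
    case True
    show ?thesis
      unfolding iff sorted_wrt_disjnt_iff all_set_conv_all_nth partition_gset_def Let_def fst_conv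
        mem_Collect_eq True by blast
  next
    case False
    then show ?thesis by (simp add: iff partition_gset_def Let_def)
  qed
qed

lemma snd_partition_gset:
  "snd (partition_gset n \<mu>) g = restrict (map ((`) g)) (fst (partition_gset n \<mu>))"
  by (simp add: partition_gset_def Let_def)

lemma finite_partition_gset: "finite_gset (sym_group n) (partition_gset n \<mu>)"
proof (rule finite_gsetI[OF sym_group_is_group])
  let ?P = "fst (partition_gset n \<mu>)"
  have "?P \<subseteq> {Ts. set Ts \<subseteq> Pow {1..n} \<and> length Ts = length \<mu>}"
    unfolding subset_iff mem_partition_gset by auto
  then show "finite ?P"
    by (rule finite_subset) (simp add: finite_lists_length_eq)
  have closed: "map ((`) g) Ts \<in> ?P" if g: "g permutes {1..n}" and Ts: "Ts \<in> ?P" for g Ts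
  proof -
    have "g ` T \<subseteq> {1..n}" if "T \<subseteq> {1..n}" for T
      using that permutes_image[OF g] by blast
    moreover have "card (g ` T) = card T" for T
      using g by (intro card_image permutes_inj_on)
    moreover have "disjnt (g ` S) (g ` T) = disjnt S T" for S T
      using image_Int[OF permutes_inj[OF g], of S T] by (auto simp: disjnt_def)
    ultimately show ?thesis
      using Ts unfolding mem_partition_gset by (auto simp: sorted_wrt_map comp_def)
  qed
  show "snd (partition_gset n \<mu>) g \<in> ?P \<rightarrow>\<^sub>E ?P" if "g \<in> carrier (sym_group n)" for g
    using closed[of g] that unfolding snd_partition_gset sym_group_carrier by (auto simp del: One_nat_def)
  show "snd (partition_gset n \<mu>) \<one>\<^bsub>sym_group n\<^esub> Ts = Ts" if "Ts \<in> ?P" for Ts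
    using that by (simp add: snd_partition_gset sym_group_one map_idI)
  show "snd (partition_gset n \<mu>) (g \<otimes>\<^bsub>sym_group n\<^esub> h) Ts =
      snd (partition_gset n \<mu>) g (snd (partition_gset n \<mu>) h Ts)"
    if "h \<in> carrier (sym_group n)" and Ts: "Ts \<in> ?P" for g h Ts
    using closed[OF _ Ts, of h] that
    by (simp add: snd_partition_gset sym_group_carrier sym_group_mult image_comp)
qed

lemma mark_natural_mset_gset:
  "mark (mset_gset k (natural_gset n)) H = int (card (stable_msets {1..n} H k))"
proof -
  have eq: "image_mset (restrict h {1..n}) M = image_mset h M" if "M \<in> multisets_of_size {1..n} k" for h M
    using that by (intro image_mset_cong) (auto simp: mem_multisets_of_size)
  have "fixed_points (mset_gset k (natural_gset n)) H =
      {M \<in> multisets_of_size {1..n} k. \<forall>h\<in>H. image_mset (restrict h {1..n}) M = M}"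
    by (simp only: fixed_mset_gset natural_gset_def fst_conv snd_conv)
  also have "\<dots> = stable_msets {1..n} H k"
    unfolding stable_msets_def by (intro Collect_cong conj_cong refl ball_cong) (simp only: eq)
  finally show ?thesis by (simp add: mark_def)
qed

text \<open>The subsets in \<open>partition_gset\<close> are nonempty because the parts of
  \<open>\<mu>\<close> are positive, and their total size is \<open>i\<close> because
  \<open>\<mu>\<close> is a partition of \<open>i\<close>.\<close>

lemma mark_partition_gset:
  assumes \<mu>: "\<mu> \<in> partitions_of i"
  shows "mark (partition_gset n \<mu>) H = int (card {Ts \<in> stable_tuples {1..n} H i. map card Ts = \<mu>})"
proof -
  have "Ts \<in> fixed_points (partition_gset n \<mu>) H \<longleftrightarrow> Ts \<in> stable_tuples {1..n} H i \<and> map card Ts = \<mu>" for Ts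
  proof (cases "map card Ts = \<mu>")
    case True
    have ne: "T \<noteq> {}" if "T \<in> set Ts" for T
    proof -
      have "card T \<in> set \<mu>" using that True by auto
      then show ?thesis using \<mu> by (auto simp: partitions_of_def)
    qed
    have act: "map ((`) h) Ts = Ts \<longleftrightarrow> (\<forall>T\<in>set Ts. h ` T = T)" for h
      using map_eq_conv[of "(`) h" Ts id] by simp
    have fixed: "Ts \<in> fixed_points (partition_gset n \<mu>) H \<longleftrightarrow>
        Ts \<in> fst (partition_gset n \<mu>) \<and> (\<forall>h\<in>H. map ((`) h) Ts = Ts)"
      using snd_partition_gset by (auto simp: fixed_points_def)
    have sum: "sum_list \<mu> = i"
      using \<mu> by (simp add: partitions_of_def)
    show ?thesis
      unfolding fixed act mem_partition_gset stable_tuples_def mem_Collect_eq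
      by (intro iffI) (simp_all add: True ne sum)
  next
    case False
    then show ?thesis by (simp add: fixed_points_def mem_partition_gset)
  qed
  then have "fixed_points (partition_gset n \<mu>) H = {Ts \<in> stable_tuples {1..n} H i. map card Ts = \<mu>}"
    by blast
  then show ?thesis by (simp add: mark_def)
qed

theorem theorem3p6:
  fixes i n :: nat
  assumes "0 < i" and "i \<le> n"
  shows "burnside_lambda (sym_group n) i (burnside_class (sym_group n) (natural_gset n)) =
    [((- 1 :: int) ^ i)] \<cdot>\<^bsub>burnside_ring (sym_group n)\<^esub>
      (\<Oplus>\<^bsub>burnside_ring (sym_group n)\<^esub> \<mu> \<in> partitions_of i.
         [((- 1 :: int) ^ length \<mu> * int (multinomial (length \<mu>) (part_mults \<mu>)))]
           \<cdot>\<^bsub>burnside_ring (sym_group n)\<^esub>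
           burnside_class (sym_group n) (partition_gset n \<mu>))"
proof -
  let ?G = "sym_group n"
  let ?R = "burnside_ring ?G"
  let ?E = "\<lambda>H i. \<Sum>Ts\<in>stable_tuples {1..n} H i. (- 1 :: int) ^ length Ts"
  interpret group ?G by (rule sym_group_is_group)
  interpret B: cring ?R by (rule burnside_ring_cring)
  define t where "t \<mu> = [((- 1 :: int) ^ length \<mu> * int (multinomial (length \<mu>) (part_mults \<mu>)))] \<cdot>\<^bsub>?R\<^esub>
    burnside_class ?G (partition_gset n \<mu>)" for \<mu>
  \<comment> \<open>The candidate is given at every index, since the description determines a whole
    series and not a single coefficient.\<close>
  define l where "l i = [((- 1 :: int) ^ i)] \<cdot>\<^bsub>?R\<^esub> (\<Oplus>\<^bsub>?R\<^esub> \<mu> \<in> partitions_of i. t \<mu>)" for i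
  have cl: "burnside_class ?G (partition_gset n \<mu>) \<in> carrier ?R" for \<mu>
    by (rule burnside_class_closed[OF finite_partition_gset])
  have t: "t \<mu> \<in> carrier ?R" for \<mu>
    using cl by (simp add: t_def)
  have l: "l i \<in> carrier ?R" for i
    using t by (simp add: l_def B.finsum_closed)
  have mark_l: "burnside_mark (l i) H = (- 1) ^ i * ?E H i" if H: "H \<subseteq> carrier ?G" for H i
  proof -
    have "burnside_mark (finsum ?R t (partitions_of i)) H = (\<Sum>\<mu>\<in>partitions_of i. burnside_mark (t \<mu>) H)"
      using t H by (intro burnside_mark_finsum finite_partitions_of) auto
    also have "\<dots> = ?E H i"
      unfolding sum_stable_tuples[OF finite_atLeastAtMost]
      by (rule sum.cong) (simp_all add: t_def burnside_mark_add_pow[OF cl H]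
          burnside_mark_class[OF finite_partition_gset H] mark_partition_gset)
    finally show ?thesis
      using t H by (simp add: l_def burnside_mark_add_pow B.finsum_closed)
  qed
  have "burnside_lambda_series ?G (burnside_class ?G (natural_gset n)) = l"
  proof (rule burnside_lambda_series_class[OF finite_natural_gset])
    fix H assume H: "H \<subseteq> carrier ?G"
    have inj: "inj_on h {1..n}" if "h \<in> H" for h
      using H that sym_group_carrier permutes_inj_on by blast
    \<comment> \<open>The sign in front of the sum and the sign from the argument \<open>-t\<close>
      cancel, leaving the signed count of tuples.\<close>
    have E: "(- 1) ^ i * burnside_mark (l i) H = ?E H i" for i
      by (simp add: mark_l[OF H] flip: mult.assoc power_mult_distrib)
    show "Abs_fps (\<lambda>n'. mark (mset_gset n' (natural_gset n)) H) *
        Abs_fps (\<lambda>n. (- 1) ^ n * burnside_mark (l n) H) = 1" (is "?F = 1")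
    proof (rule fps_ext)
      fix i
      show "fps_nth ?F i = fps_nth 1 i"
      proof (cases "i = 0")
        case True
        \<comment> \<open>Members of a tuple are nonempty, so total size 0 leaves only the empty
          tuple, and the constant coefficient is 1.\<close>
        have "stable_tuples {1..n} H 0 = {[]}"
        proof -
          have "Ts = []" if "Ts \<in> stable_tuples {1..n} H 0" for Ts
          proof (cases Ts)
            case (Cons T Us)
            with that have "card T = 0" "T \<subseteq> {1..n}" "T \<noteq> {}" by (auto simp: stable_tuples_def)
            then show ?thesis using finite_subset[of T "{1..n}"] by simp
          qed simp
          then show ?thesis by (auto simp: stable_tuples_def)
        qed
        then show ?thesis using True E[of 0] by (simp add: mark_mset_gset_0)
      next
        case False
        \<comment> \<open>At a positive index the coefficient is the signed count of pairs, which
          the involution makes vanish.\<close>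
        then have "fps_nth ?F i = 0"
          using sum_stable_pairs[OF finite_atLeastAtMost inj, of H i]
          by (simp add: fps_mult_nth E mark_natural_mset_gset atLeast0AtMost)
        with False show ?thesis by simp
      qed
    qed
  qed (use l in auto)
  then show ?thesis
    by (simp add: burnside_lambda_def l_def t_def)
qed

end
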